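(* Let $p=p_n\in(0,1)$ with $p=\Omega(1)$, let $k=k_n\in\mathbb{N}$ with $k\le n$, and let $q=q_n\in(0,1]$ with $kq=\omega(\log k)$. Consider $\mathrm{PDS}(k,p,q)$, where $H=H_n$ is drawn from $G(k,q)$ and one considers the planted subgraph detection task for $H$ and $p$. With probability $1-o(1)$ over $H$, the following holds: some constant-degree polynomial achieves strong separation between $\mathbb{P}$ and $\mathbb{Q}$ if and only if $$k=\omega\left(\frac{\sqrt n}{\sqrt q\,(1-p)^{1/4}}\right).$$ Moreover, if $k=\omega\left(\frac{\sqrt n}{\sqrt q\,(1-p)^{1/4}}\right)$, then counting signed edges, i.e. $f=\sum_{\{i,j\}\in\binom{[n]}2}\chi_{\{i,j\}}$, achieves strong separation. (Here "with probability $1-o(1)$ over $H$" means: there are sets $\mathcal{H}_n$ of graphs with $\Pr_{H\sim G(k,q)}[H\in\mathcal{H}_n]\to1$ such that the assertions hold for every deterministic sequence $H_n\in\mathcal{H}_n$.)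
   Context: Asymptotics are as $n\to\infty$. $a_n=o(b_n)$ means $a_n/b_n\to0$ (in particular $b_n\neq 0$ for large $n$), and $a_n=\omega(b_n)$ means $a_n/b_n\to\infty$ (for nonnegative sequences). $p=\Omega(1)$ means $\liminf_n p_n>0$. A constant-degree polynomial means a (sequence of) polynomial(s) of degree $O(1)$. Graphs on vertex set $[n]$ are identified with vectors $G=(G_{\{i,j\}})\in\{0,1\}^{\binom n2}$ of edge indicators. $G(n,p)$ is the Erdős–Rényi random graph. Planted subgraph detection task for $H$ and $p$: under the null $\mathbb{Q}=G(n,p)$ one observes $G(n,p)$; under $\mathbb{P}$ one observes the union of $G(n,p)$ with an independent random copy of $H$, chosen uniformly among all labelled copies of $H$ in the complete graph $K_n$ (i.e. the image of $H$ under a uniformly random injection $V(H)\to[n]$). In $\mathrm{PDS}(k,p,q)$ (planted dense subgraph), $H$ is first drawn from $G(k,q)$ and then the task for this $H$ is considered. A (sequence of) polynomial(s) $f$ in the $\binom n2$ variables $G_{\{i,j\}}$ strongly separates $\mathbb{P}$ and $\mathbb{Q}$ if $\max\{\sqrt{\mathrm{Var}_{\mathbb{P}}(f)},\sqrt{\mathrm{Var}_{\mathbb{Q}}(f)}\}=o(|\mathbb{E}_{\mathbb{P}}f-\mathbb{E}_{\mathbb{Q}}f|)$. $\chi_{\{i,j\}}(G)=\frac{G_{\{i,j\}}-p}{\sqrt{p(1-p)}}$. *)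

theory Defs
  imports "HOL-Probability.Probability" "HOL-Library.Poly_Mapping"
begin

definition pairs :: "nat \<Rightarrow> nat set set" where
  "pairs n = {e. e \<subseteq> {1..n} \<and> card e = 2}"

text \<open>A graph is its vector of edge indicators, extended by \<^term>\<open>False\<close> outside the
  \<open>n choose 2\<close> coordinates.\<close>

type_synonym graph = "nat set \<Rightarrow> bool"

definition graphs :: "nat \<Rightarrow> graph set" where
  "graphs n = {G. \<forall>e. G e \<longrightarrow> e \<in> pairs n}"

definition erdos_renyi :: "nat \<Rightarrow> real \<Rightarrow> graph pmf" where
  "erdos_renyi n p = Pi_pmf (pairs n) False (\<lambda>_. bernoulli_pmf p)"

definition injections :: "nat \<Rightarrow> nat \<Rightarrow> (nat \<Rightarrow> nat) set" where
  "injections k n = {\<phi> \<in> {1..k} \<rightarrow>\<^sub>E {1..n}. inj_on \<phi> {1..k}}"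

definition graph_image :: "(nat \<Rightarrow> nat) \<Rightarrow> graph \<Rightarrow> graph" where
  "graph_image \<phi> H = (\<lambda>e. \<exists>e'. H e' \<and> e = \<phi> ` e')"

definition graph_union :: "graph \<Rightarrow> graph \<Rightarrow> graph" where
  "graph_union G G' = (\<lambda>e. G e \<or> G' e)"

text \<open>The planted distribution for a graph \<open>H\<close> on the vertex set \<open>{1..k}\<close> (isolated vertices
  included), with \<open>k \<le> n\<close>; the null distribution is \<^term>\<open>erdos_renyi n p\<close>.\<close>

definition planted :: "nat \<Rightarrow> real \<Rightarrow> nat \<Rightarrow> graph \<Rightarrow> graph pmf" where
  "planted n p k H =
     map_pmf (\<lambda>(G, \<phi>). graph_union G (graph_image \<phi> H))
       (pair_pmf (erdos_renyi n p) (pmf_of_set (injections k n)))"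

text \<open>Real multivariate polynomials with one indeterminate per pair of vertices: a polynomial
  maps monomials (exponent vectors) to coefficients.\<close>

type_synonym edge_poly = "(nat set \<Rightarrow>\<^sub>0 nat) \<Rightarrow>\<^sub>0 real"

definition poly_vars :: "edge_poly \<Rightarrow> nat set set" where
  "poly_vars P = (\<Union>m\<in>Poly_Mapping.keys P. Poly_Mapping.keys m)"

definition total_degree :: "edge_poly \<Rightarrow> nat" where
  "total_degree P =
     Max (insert 0 ((\<lambda>m. \<Sum>e\<in>Poly_Mapping.keys m. Poly_Mapping.lookup m e) ` Poly_Mapping.keys P))"

definition eval_poly :: "edge_poly \<Rightarrow> graph \<Rightarrow> real" where
  "eval_poly P G =
     (\<Sum>m\<in>Poly_Mapping.keys P. Poly_Mapping.lookup P m *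
        (\<Prod>e\<in>Poly_Mapping.keys m. of_bool (G e) ^ Poly_Mapping.lookup m e))"

definition constant_degree :: "(nat \<Rightarrow> edge_poly) \<Rightarrow> bool" where
  "constant_degree F \<longleftrightarrow>
     (\<forall>n. poly_vars (F n) \<subseteq> pairs n) \<and> (\<exists>D. \<forall>n. total_degree (F n) \<le> D)"

text \<open>Unlike Landau's \<open>o\<close>, \<open>little_o a b\<close> requires \<open>b\<close> to be eventually nonzero. Both relations
  are limits of the quotient; since \<open>x / 0 = 0\<close>, \<open>little_omega a b\<close> also forces \<open>b\<close> to be
  eventually nonzero.\<close>

definition little_o :: "(nat \<Rightarrow> real) \<Rightarrow> (nat \<Rightarrow> real) \<Rightarrow> bool" where
  "little_o a b \<longleftrightarrow> (\<forall>\<^sub>F n in sequentially. b n \<noteq> 0) \<and> (\<lambda>n. a n / b n) \<longlonglongrightarrow> 0"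

definition little_omega :: "(nat \<Rightarrow> real) \<Rightarrow> (nat \<Rightarrow> real) \<Rightarrow> bool" where
  "little_omega a b \<longleftrightarrow> filterlim (\<lambda>n. a n / b n) at_top sequentially"

definition strongly_separates ::
    "(nat \<Rightarrow> graph \<Rightarrow> real) \<Rightarrow> (nat \<Rightarrow> graph pmf) \<Rightarrow> (nat \<Rightarrow> graph pmf) \<Rightarrow> bool" where
  "strongly_separates f P Q \<longleftrightarrow>
     little_o
       (\<lambda>n. max (sqrt (measure_pmf.variance (P n) (f n))) (sqrt (measure_pmf.variance (Q n) (f n))))
       (\<lambda>n. \<bar>measure_pmf.expectation (P n) (f n) - measure_pmf.expectation (Q n) (f n)\<bar>)"

definition chi :: "real \<Rightarrow> nat set \<Rightarrow> graph \<Rightarrow> real" where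
  "chi p e G = (of_bool (G e) - p) / sqrt (p * (1 - p))"

definition signed_edge_count :: "nat \<Rightarrow> real \<Rightarrow> graph \<Rightarrow> real" where
  "signed_edge_count n p G = (\<Sum>e\<in>pairs n. chi p e G)"

end

theory Submission
  imports Defs
begin

text \<open>
  Write \<open>\<theta> = (1 - p) / p\<close> and \<open>\<rho> = k\<^sup>2 q (1 - p)\<^bsup>1/2\<^esup> / n\<close>. The threshold condition on \<open>k\<close> is, after
  squaring, \<open>\<rho> \<rightarrow> \<infinity>\<close>. About \<open>H\<close> only two facts matter, and both hold with high probability by
  exponential moment bounds: all degrees are at most \<open>4kq\<close> (the union bound over the vertices
  is where \<open>kq \<gg> log k\<close> enters), and there are at least \<open>k\<^sup>2q/8\<close> edges (\<open>typical_graphs\<close>).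

  Above the threshold, the signed edge count has mean \<open>0\<close> under the null and mean
  \<open>\<theta>\<^bsup>1/2\<^esup> |E(H)|\<close> under the planted distribution. Conditionally on the position of the copy of
  \<open>H\<close> it is a constant, independent of the position, plus a sum of independent centred terms of
  variance one, so both variances are at most \<open>n choose 2\<close>. The ratio of standard deviation to
  mean gap is thus \<open>O(1/\<rho>)\<close>.

  Below the threshold, on the cube of edge indicators every polynomial of degree at most \<open>D\<close> is
  a combination of the characters \<open>\<Prod>\<^bsub>e\<in>\<alpha>\<^esub> \<chi>\<^sub>e\<close> with \<open>|\<alpha>| \<le> D\<close>, which are orthonormal under the
  null. By Cauchy-Schwarz the squared mean gap is at most the null variance times
  \<open>\<Sum> (E\<^sub>P \<chi>\<^sub>\<alpha>)\<^sup>2 = \<Sum> \<theta>\<^bsup>|\<alpha>|\<^esup> Pr[\<alpha> \<subseteq> copy]\<^sup>2\<close> over \<open>1 \<le> |\<alpha>| \<le> D\<close>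
  (\<open>low_degree_gap_le_variance\<close>). It remains to bound this sum along any sequence of \<open>n\<close> on
  which \<open>\<rho>\<close> stays bounded.

  The sum is controlled by adding the edges of \<open>\<alpha>\<close> one at a time. The law of the copy is
  invariant under permutations of the vertices, so the probability of containing \<open>\<alpha> + e\<close> is
  the same for all \<open>e\<close> disjoint from \<open>\<alpha>\<close>, and for all \<open>e\<close> hanging from a given vertex of \<open>\<alpha>\<close>;
  averaging over all such \<open>e\<close> bounds it by \<open>O(|E(H)|/n\<^sup>2)\<close> and \<open>O(\<Delta>/n)\<close> times the probability of
  containing \<open>\<alpha>\<close>, with \<open>\<Delta>\<close> the maximum degree. Edges inside the vertex set of \<open>\<alpha>\<close> are boundedly
  many. After squaring and summing over \<open>e\<close>, each new edge costs a factor
  \<open>\<theta> O(k\<^sup>2\<Delta>\<^sup>2/n\<^sup>2 + \<Delta>\<^sup>2/n + 1)\<close> (\<open>sum_containing_insert\<close>), and with \<open>\<Delta> = 4kq\<close> and \<open>p\<close> bounded away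
  from \<open>0\<close> this is \<open>O(\<rho>\<^sup>2 + \<rho> + 1)\<close>.
\<close>

section \<open>Orthonormal characters of the random graph\<close>

lemma finite_pairs: "finite (pairs n)"
  unfolding pairs_def by (rule finite_subset[of _ "Pow {1..n}"]) auto

lemma finite_set_erdos_renyi: "finite (set_pmf (erdos_renyi n p))"
  unfolding erdos_renyi_def
  by (rule finite_subset[OF set_Pi_pmf_subset'[OF finite_pairs]])
     (auto intro!: finite_PiE_dflt finite_pairs)

lemma integrable_erdos_renyi: "integrable (measure_pmf (erdos_renyi n p)) (f :: graph \<Rightarrow> real)"
  by (rule integrable_measure_pmf_finite[OF finite_set_erdos_renyi])

text \<open>
  Independence of the coordinates, for factors of arbitrary sign: the signed case is what
  orthogonality of the characters needs.
\<close>

lemma expectation_prod_bernoulli: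
  fixes g :: "'a \<Rightarrow> bool \<Rightarrow> real"
  assumes "finite A" "0 \<le> p" "p \<le> 1"
  shows "measure_pmf.expectation (Pi_pmf A False (\<lambda>_. bernoulli_pmf p)) (\<lambda>G. \<Prod>e\<in>A. g e (G e)) =
         (\<Prod>e\<in>A. g e True * p + g e False * (1 - p))"
  using assms(1)
proof (induction A)
  case empty
  then show ?case by simp
next
  case (insert x A)
  let ?P = "Pi_pmf A False (\<lambda>_. bernoulli_pmf p)"
  have fin: "finite (set_pmf ?P)"
    by (rule finite_subset[OF set_Pi_pmf_subset'[OF insert(1)]])
       (auto intro!: finite_PiE_dflt insert(1))
  have "Pi_pmf (insert x A) False (\<lambda>_. bernoulli_pmf p) =
      bernoulli_pmf p \<bind> (\<lambda>b. map_pmf (\<lambda>G. G(x := b)) ?P)"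
    using insert by (simp add: Pi_pmf_insert' map_pmf_def)
  then have step: "measure_pmf.expectation (Pi_pmf (insert x A) False (\<lambda>_. bernoulli_pmf p))
       (\<lambda>G. \<Prod>e\<in>insert x A. g e (G e)) =
     (\<Sum>b\<in>UNIV. pmf (bernoulli_pmf p) b *
        measure_pmf.expectation ?P (\<lambda>G. \<Prod>e\<in>insert x A. g e ((G(x := b)) e)))"
    using fin by (simp add: pmf_expectation_bind[of UNIV])
  have eq: "(\<lambda>G. \<Prod>e\<in>insert x A. g e ((G(x := b)) e)) = (\<lambda>G. g x b * (\<Prod>e\<in>A. g e (G e)))" for b
  proof
    fix G :: "'a \<Rightarrow> bool"
    have "(\<Prod>e\<in>A. g e ((G(x := b)) e)) = (\<Prod>e\<in>A. g e (G e))"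
      using insert(2) by (intro prod.cong) auto
    then show "(\<Prod>e\<in>insert x A. g e ((G(x := b)) e)) = g x b * (\<Prod>e\<in>A. g e (G e))"
      using insert(1,2) by simp
  qed
  show ?case
    unfolding step eq using insert assms(2,3) by (simp add: UNIV_bool algebra_simps)
qed

lemma expectation_erdos_renyi_prod:
  fixes g :: "nat set \<Rightarrow> bool \<Rightarrow> real"
  assumes "S \<subseteq> pairs n" "0 \<le> p" "p \<le> 1"
  shows "measure_pmf.expectation (erdos_renyi n p) (\<lambda>G. \<Prod>e\<in>S. g e (G e)) =
         (\<Prod>e\<in>S. g e True * p + g e False * (1 - p))"
proof -
  have *: "(\<Prod>e\<in>S. f e) = (\<Prod>e\<in>pairs n. if e \<in> S then f e else 1)" for f :: "nat set \<Rightarrow> real"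
    using assms(1) finite_pairs by (simp add: prod.If_cases Int_absorb1)
  show ?thesis
    using expectation_prod_bernoulli[OF finite_pairs assms(2,3), of n "\<lambda>e b. if e \<in> S then g e b else 1"]
    unfolding erdos_renyi_def * by (auto intro: prod.cong)
qed

text \<open>
  The \<open>p\<close>-biased Walsh characters of the cube.
\<close>

definition char_monomial :: "real \<Rightarrow> nat set set \<Rightarrow> graph \<Rightarrow> real" where
  "char_monomial p \<alpha> G = (\<Prod>e\<in>\<alpha>. chi p e G)"

text \<open>
  The two values of \<^const>\<open>chi\<close> are written out here: it is centred and of variance one on a
  random edge, and equals \<open>((1 - p) / p)\<^bsup>1/2\<^esup>\<close> on an edge that is present.
\<close>

lemma chi_moments:
  assumes "0 < p" "p < 1"
  shows "((1 - p) / sqrt (p * (1 - p))) * p + ((0 - p) / sqrt (p * (1 - p))) * (1 - p) = 0"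
    and "((1 - p) / sqrt (p * (1 - p)))\<^sup>2 * p + ((0 - p) / sqrt (p * (1 - p)))\<^sup>2 * (1 - p) = 1"
    and "(1 - p) / sqrt (p * (1 - p)) = sqrt ((1 - p) / p)"
proof -
  show "((1 - p) / sqrt (p * (1 - p))) * p + ((0 - p) / sqrt (p * (1 - p))) * (1 - p) = 0"
    by (simp add: field_simps)
  have "(sqrt (p * (1 - p)))\<^sup>2 = p * (1 - p)" using assms by simp
  then show "((1 - p) / sqrt (p * (1 - p)))\<^sup>2 * p + ((0 - p) / sqrt (p * (1 - p)))\<^sup>2 * (1 - p) = 1"
    using assms by (simp add: power_divide divide_simps) (simp add: power2_eq_square algebra_simps)
  show "(1 - p) / sqrt (p * (1 - p)) = sqrt ((1 - p) / p)"
    using assms real_div_sqrt[of "1 - p"] by (simp add: real_sqrt_mult real_sqrt_divide divide_simps)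
qed

text \<open>
  Edges in both \<open>\<alpha>\<close> and \<open>\<beta>\<close> contribute the variance one, edges in exactly one of them the mean zero,
  so the product over \<open>\<alpha> \<union> \<beta>\<close> vanishes unless the two sets agree.
\<close>

lemma expectation_char_monomial_mult:
  assumes "0 < p" "p < 1" "\<alpha> \<subseteq> pairs n" "\<beta> \<subseteq> pairs n"
  shows "measure_pmf.expectation (erdos_renyi n p) (\<lambda>G. char_monomial p \<alpha> G * char_monomial p \<beta> G) =
         of_bool (\<alpha> = \<beta>)"
proof -
  define x where "x e b = (of_bool b - p) / sqrt (p * (1 - p))" for e :: "nat set" and b
  define g where "g e b = (if e \<in> \<alpha> then x e b else 1) * (if e \<in> \<beta> then x e b else 1)" for e b
  have fin: "finite (\<alpha> \<union> \<beta>)" using assms finite_pairs by (meson Un_least finite_subset)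
  have "char_monomial p \<alpha> G * char_monomial p \<beta> G = (\<Prod>e\<in>\<alpha> \<union> \<beta>. g e (G e))" for G
  proof -
    have "(\<Prod>e\<in>\<alpha>. chi p e G) = (\<Prod>e\<in>\<alpha> \<union> \<beta>. if e \<in> \<alpha> then x e (G e) else 1)"
      using fin by (simp add: prod.If_cases chi_def x_def Int_absorb1)
    moreover have "(\<Prod>e\<in>\<beta>. chi p e G) = (\<Prod>e\<in>\<alpha> \<union> \<beta>. if e \<in> \<beta> then x e (G e) else 1)"
      using fin by (simp add: prod.If_cases chi_def x_def Int_absorb1)
    ultimately show ?thesis by (simp add: char_monomial_def g_def prod.distrib)
  qed
  then have "measure_pmf.expectation (erdos_renyi n p) (\<lambda>G. char_monomial p \<alpha> G * char_monomial p \<beta> G)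
    = (\<Prod>e\<in>\<alpha> \<union> \<beta>. g e True * p + g e False * (1 - p))"
    using expectation_erdos_renyi_prod[of "\<alpha> \<union> \<beta>" n p g] assms by simp
  also have "\<dots> = (\<Prod>e\<in>\<alpha> \<union> \<beta>. of_bool (e \<in> \<alpha> \<inter> \<beta>))"
    using chi_moments(1,2)[OF assms(1,2)]
    by (intro prod.cong refl) (auto simp: g_def x_def power2_eq_square)
  also have "\<dots> = of_bool (\<alpha> = \<beta>)"
    using fin by (cases "\<alpha> = \<beta>") (auto intro!: prod.neutral prod_zero)
  finally show ?thesis .
qed

lemma expectation_square_char_sum:
  assumes "0 < p" "p < 1" "finite \<Lambda>" "\<And>\<alpha>. \<alpha> \<in> \<Lambda> \<Longrightarrow> \<alpha> \<subseteq> pairs n"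
  shows "measure_pmf.expectation (erdos_renyi n p) (\<lambda>G. (\<Sum>\<alpha>\<in>\<Lambda>. c \<alpha> * char_monomial p \<alpha> G)\<^sup>2) =
         (\<Sum>\<alpha>\<in>\<Lambda>. (c \<alpha>)\<^sup>2)"
proof -
  have "measure_pmf.expectation (erdos_renyi n p) (\<lambda>G. (\<Sum>\<alpha>\<in>\<Lambda>. c \<alpha> * char_monomial p \<alpha> G)\<^sup>2) =
    measure_pmf.expectation (erdos_renyi n p) (\<lambda>G. \<Sum>\<alpha>\<in>\<Lambda>. \<Sum>\<beta>\<in>\<Lambda>.
      (c \<alpha> * c \<beta>) * (char_monomial p \<alpha> G * char_monomial p \<beta> G))"
    by (simp add: power2_eq_square sum_product algebra_simps)
  also have "\<dots> = (\<Sum>\<alpha>\<in>\<Lambda>. \<Sum>\<beta>\<in>\<Lambda>. (c \<alpha> * c \<beta>) * of_bool (\<alpha> = \<beta>))"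
    using assms(4) by (simp add: integrable_erdos_renyi expectation_char_monomial_mult[OF assms(1,2)])
  also have "\<dots> = (\<Sum>\<alpha>\<in>\<Lambda>. (c \<alpha>)\<^sup>2)"
    using assms(3) by (simp add: power2_eq_square of_bool_def if_distrib[of "\<lambda>x. _ * x"] sum.delta cong: if_cong)
  finally show ?thesis .
qed

lemma expectation_erdos_renyi_char_monomial:
  assumes "0 < p" "p < 1" "\<alpha> \<subseteq> pairs n" "\<alpha> \<noteq> {}"
  shows "measure_pmf.expectation (erdos_renyi n p) (char_monomial p \<alpha>) = 0"
  using expectation_char_monomial_mult[OF assms(1-3), of "{}"] assms(4) by (simp add: char_monomial_def[abs_def])

section \<open>Moments under the planted distribution\<close>

lemma finite_injections: "finite (injections k n)"
  unfolding injections_def by (rule finite_subset[of _ "{1..k} \<rightarrow>\<^sub>E {1..n}"]) (auto intro: finite_PiE)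

lemma injections_nonempty:
  assumes "k \<le> n"
  shows "injections k n \<noteq> {}"
proof -
  have "restrict id {1..k} \<in> injections k n"
    using assms by (auto simp: injections_def inj_on_def)
  then show ?thesis by blast
qed

text \<open>
  Conditioning on the position of the planted copy: the planted mean is an average of null means.
\<close>

lemma expectation_planted:
  fixes f :: "graph \<Rightarrow> real"
  assumes "k \<le> n"
  shows "measure_pmf.expectation (planted n p k H) f =
    (\<Sum>\<phi>\<in>injections k n. measure_pmf.expectation (erdos_renyi n p)
        (\<lambda>G. f (graph_union G (graph_image \<phi> H)))) / card (injections k n)"
proof -
  have "planted n p k H = pmf_of_set (injections k n) \<bind>
    (\<lambda>\<phi>. map_pmf (\<lambda>G. graph_union G (graph_image \<phi> H)) (erdos_renyi n p))"
    unfolding planted_def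
    by (subst pair_commute_pmf) (simp add: pair_pmf_def map_pmf_def bind_assoc_pmf bind_return_pmf)
  then show ?thesis
    using injections_nonempty[OF assms] finite_injections finite_set_erdos_renyi
    by (simp add: pmf_expectation_bind_pmf_of_set sum_divide_distrib sum_distrib_left divide_inverse mult.commute)
qed

text \<open>
  The random copy of \<open>H\<close> is given by its position, a uniformly random injection. The share of
  these injections among all of them is the probability that the copy contains all edges of \<open>\<alpha>\<close>;
  they are counted rather than measured because the bounds below come from double counting.
\<close>

definition containing :: "nat \<Rightarrow> nat \<Rightarrow> graph \<Rightarrow> nat set set \<Rightarrow> (nat \<Rightarrow> nat) set" where
  "containing k n H \<alpha> = {\<phi> \<in> injections k n. \<forall>e\<in>\<alpha>. graph_image \<phi> H e}"

text \<open>
  For a fixed position, an edge of \<open>\<alpha>\<close> outside the copy is still centred and kills the whole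
  product, while edges inside the copy are deterministic. Only the positions whose copy
  contains all of \<open>\<alpha>\<close> survive.
\<close>

lemma expectation_planted_char_monomial:
  assumes "0 < p" "p < 1" "\<alpha> \<subseteq> pairs n" "k \<le> n"
  shows "measure_pmf.expectation (planted n p k H) (char_monomial p \<alpha>) =
    sqrt ((1 - p) / p) ^ card \<alpha> * (card (containing k n H \<alpha>) / card (injections k n))"
proof -
  have fin: "finite \<alpha>" using assms(3) finite_pairs finite_subset by blast
  have "measure_pmf.expectation (erdos_renyi n p) (\<lambda>G. char_monomial p \<alpha> (graph_union G K)) =
      (if \<forall>e\<in>\<alpha>. K e then sqrt ((1 - p) / p) ^ card \<alpha> else 0)" for K
  proof -
    define g where "g e b = (of_bool (b \<or> K e) - p) / sqrt (p * (1 - p))" for e b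
    have "measure_pmf.expectation (erdos_renyi n p) (\<lambda>G. char_monomial p \<alpha> (graph_union G K)) =
      (\<Prod>e\<in>\<alpha>. g e True * p + g e False * (1 - p))"
      using expectation_erdos_renyi_prod[of \<alpha> n p g] assms
      by (simp add: char_monomial_def chi_def g_def graph_union_def)
    also have "\<dots> = (\<Prod>e\<in>\<alpha>. if K e then sqrt ((1 - p) / p) else 0)"
    proof (rule prod.cong[OF refl])
      fix e
      show "g e True * p + g e False * (1 - p) = (if K e then sqrt ((1 - p) / p) else 0)"
      proof (cases "K e")
        case True
        then have "g e b = sqrt ((1 - p) / p)" for b
          using chi_moments(3)[OF assms(1,2)] by (simp add: g_def)
        then show ?thesis using True by (simp add: algebra_simps)
      next
        case False
        then show ?thesis using chi_moments(1)[OF assms(1,2)] by (simp add: g_def)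
      qed
    qed
    finally show ?thesis using fin by (auto simp: prod_zero_iff)
  qed
  then show ?thesis
    using finite_injections assms(4)
    by (simp add: expectation_planted sum.If_cases containing_def Int_def conj_commute)
qed

lemma finite_set_planted:
  assumes "k \<le> n"
  shows "finite (set_pmf (planted n p k H))"
  unfolding planted_def
  using finite_set_erdos_renyi injections_nonempty[OF assms] finite_injections by simp

lemma expectation_planted_sum:
  assumes "k \<le> n"
  shows "measure_pmf.expectation (planted n p k H) (\<lambda>G. \<Sum>i\<in>I. c i * f i G) =
    (\<Sum>i\<in>I. c i * measure_pmf.expectation (planted n p k H) (f i :: graph \<Rightarrow> real))"
  by (simp add: integrable_measure_pmf_finite[OF finite_set_planted[OF assms]])

section \<open>The mean gap of a low-degree polynomial\<close>

text \<open>
  Positive powers of an indicator are the indicator itself, so a monomial is a product of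
  \<open>G\<^sub>e = \<sigma> \<chi>\<^sub>e + p\<close>, with \<open>\<sigma>\<close> the standard deviation of an edge indicator, over its support.
  Expanding this product gives characters of subsets of the support, whose size is at most the
  degree.
\<close>

lemma eval_poly_char_expansion:
  assumes "0 < p" "p < 1" "poly_vars F \<subseteq> pairs n" "total_degree F \<le> D"
  shows "\<exists>c. \<forall>G. eval_poly F G = (\<Sum>\<alpha> | \<alpha> \<subseteq> pairs n \<and> card \<alpha> \<le> D. c \<alpha> * char_monomial p \<alpha> G)"
proof -
  define \<Lambda> where "\<Lambda> = {\<alpha>. \<alpha> \<subseteq> pairs n \<and> card \<alpha> \<le> D}"
  have fin\<Lambda>: "finite \<Lambda>" unfolding \<Lambda>_def using finite_pairs by simp
  define s where "s = sqrt (p * (1 - p))"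
  have s: "s > 0" using assms by (simp add: s_def)
  have mono: "\<exists>c. \<forall>G. (\<Prod>e\<in>Poly_Mapping.keys m. of_bool (G e) ^ Poly_Mapping.lookup m e) =
      (\<Sum>\<alpha>\<in>\<Lambda>. c \<alpha> * char_monomial p \<alpha> G)" if m: "m \<in> Poly_Mapping.keys F" for m
  proof -
    define S where "S = Poly_Mapping.keys m"
    have S: "finite S" "S \<subseteq> pairs n" using assms(3) m by (auto simp: S_def poly_vars_def)
    have "card S = (\<Sum>e\<in>S. 1)" by simp
    also have "\<dots> \<le> (\<Sum>e\<in>S. Poly_Mapping.lookup m e)"
      by (rule sum_mono) (auto simp: S_def in_keys_iff)
    also have "\<dots> \<le> total_degree F"
      using m by (auto simp: total_degree_def S_def intro!: Max_ge)
    finally have card: "card S \<le> D" using assms(4) by simp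
    have sub: "Pow S \<subseteq> \<Lambda>"
      using S card by (auto simp: \<Lambda>_def) (meson card_mono le_trans)
    have "(\<Prod>e\<in>S. of_bool (G e) ^ Poly_Mapping.lookup m e) =
      (\<Sum>\<alpha>\<in>\<Lambda>. (if \<alpha> \<subseteq> S then s ^ card \<alpha> * p ^ card (S - \<alpha>) else 0) * char_monomial p \<alpha> G)" for G
    proof -
      have "(\<Prod>e\<in>S. of_bool (G e) ^ Poly_Mapping.lookup m e) = (\<Prod>e\<in>S. s * chi p e G + p)"
        using s by (intro prod.cong) (auto simp: chi_def s_def[symmetric] S_def in_keys_iff)
      also have "\<dots> = (\<Sum>\<alpha>\<in>Pow S. (s ^ card \<alpha> * p ^ card (S - \<alpha>)) * char_monomial p \<alpha> G)"
        unfolding prod_add[OF S(1)] by (simp add: prod.distrib char_monomial_def algebra_simps)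
      also have "\<dots> = (\<Sum>\<alpha>\<in>\<Lambda>. (if \<alpha> \<subseteq> S then s ^ card \<alpha> * p ^ card (S - \<alpha>) else 0) * char_monomial p \<alpha> G)"
        by (rule sum.mono_neutral_cong_left[OF fin\<Lambda> sub]) auto
      finally show ?thesis .
    qed
    then show ?thesis unfolding S_def[symmetric] by (intro exI allI)
  qed
  then obtain c where c: "\<And>m G. m \<in> Poly_Mapping.keys F \<Longrightarrow>
      (\<Prod>e\<in>Poly_Mapping.keys m. of_bool (G e) ^ Poly_Mapping.lookup m e) =
      (\<Sum>\<alpha>\<in>\<Lambda>. c m \<alpha> * char_monomial p \<alpha> G)"
    by metis
  have "eval_poly F G = (\<Sum>\<alpha>\<in>\<Lambda>. (\<Sum>m\<in>Poly_Mapping.keys F. Poly_Mapping.lookup F m * c m \<alpha>) * char_monomial p \<alpha> G)" for G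
    unfolding eval_poly_def
    by (simp add: c sum_distrib_left sum_distrib_right mult.assoc cong: sum.cong) (rule sum.swap)
  then show ?thesis unfolding \<Lambda>_def
    by (intro exI[of _ "\<lambda>\<alpha>. \<Sum>m\<in>Poly_Mapping.keys F. Poly_Mapping.lookup F m * c m \<alpha>"]) simp
qed

text \<open>
  In the character expansion the constant term cancels in the mean gap, and the squared
  coefficients of the others add up to the null variance; the claim is Cauchy-Schwarz for the
  remaining terms.
\<close>

lemma low_degree_gap_le_variance:
  assumes p: "0 < p" "p < 1" and F: "poly_vars F \<subseteq> pairs n" "total_degree F \<le> D" and k: "k \<le> n"
  shows "(measure_pmf.expectation (planted n p k H) (eval_poly F) -
          measure_pmf.expectation (erdos_renyi n p) (eval_poly F))\<^sup>2
    \<le> (\<Sum>\<alpha> | \<alpha> \<subseteq> pairs n \<and> 1 \<le> card \<alpha> \<and> card \<alpha> \<le> D.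
          ((1 - p) / p) ^ card \<alpha> * (card (containing k n H \<alpha>) / card (injections k n))\<^sup>2)
      * measure_pmf.variance (erdos_renyi n p) (eval_poly F)"
proof -
  define \<Lambda> where "\<Lambda> = {\<alpha>. \<alpha> \<subseteq> pairs n \<and> 1 \<le> card \<alpha> \<and> card \<alpha> \<le> D}"
  have fin: "finite \<Lambda>" unfolding \<Lambda>_def using finite_pairs by simp
  have \<Lambda>: "\<alpha> \<subseteq> pairs n" "\<alpha> \<noteq> {}" if "\<alpha> \<in> \<Lambda>" for \<alpha> using that by (auto simp: \<Lambda>_def)
  have empty: "card \<alpha> = 0 \<longleftrightarrow> \<alpha> = {}" if "\<alpha> \<subseteq> pairs n" for \<alpha>
    using that finite_pairs finite_subset by (metis card_0_eq)
  have split: "{\<alpha>. \<alpha> \<subseteq> pairs n \<and> card \<alpha> \<le> D} = insert {} \<Lambda>"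
    using empty by (auto simp: \<Lambda>_def Suc_le_eq)
  have "{} \<notin> \<Lambda>" by (simp add: \<Lambda>_def)
  obtain c where "eval_poly F G = (\<Sum>\<alpha> | \<alpha> \<subseteq> pairs n \<and> card \<alpha> \<le> D. c \<alpha> * char_monomial p \<alpha> G)" for G
    using eval_poly_char_expansion[OF p F] by blast
  then have ev: "eval_poly F = (\<lambda>G. c {} + (\<Sum>\<alpha>\<in>\<Lambda>. c \<alpha> * char_monomial p \<alpha> G))"
    unfolding split using fin \<open>{} \<notin> \<Lambda>\<close> by (simp add: char_monomial_def fun_eq_iff)
  have Q: "measure_pmf.expectation (erdos_renyi n p) (eval_poly F) = c {}"
    unfolding ev using \<Lambda> by (simp add: integrable_erdos_renyi expectation_erdos_renyi_char_monomial[OF p])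
  have V: "measure_pmf.variance (erdos_renyi n p) (eval_poly F) = (\<Sum>\<alpha>\<in>\<Lambda>. (c \<alpha>)\<^sup>2)"
    unfolding Q using \<Lambda> by (simp add: ev expectation_square_char_sum[OF p fin])
  have "measure_pmf.expectation (planted n p k H) (eval_poly F) =
    measure_pmf.expectation (planted n p k H) (\<lambda>G. \<Sum>\<alpha>\<in>insert {} \<Lambda>. c \<alpha> * char_monomial p \<alpha> G)"
    unfolding ev using fin \<open>{} \<notin> \<Lambda>\<close> by (simp add: char_monomial_def)
  also have "\<dots> = c {} + (\<Sum>\<alpha>\<in>\<Lambda>. c \<alpha> * measure_pmf.expectation (planted n p k H) (char_monomial p \<alpha>))"
    unfolding expectation_planted_sum[OF k] using fin \<open>{} \<notin> \<Lambda>\<close>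
    by (simp add: char_monomial_def[abs_def])
  finally have "(measure_pmf.expectation (planted n p k H) (eval_poly F) -
          measure_pmf.expectation (erdos_renyi n p) (eval_poly F))\<^sup>2 =
      (\<Sum>\<alpha>\<in>\<Lambda>. measure_pmf.expectation (planted n p k H) (char_monomial p \<alpha>) * c \<alpha>)\<^sup>2"
    unfolding Q by (simp add: mult.commute)
  also have "\<dots> \<le> (\<Sum>\<alpha>\<in>\<Lambda>. (measure_pmf.expectation (planted n p k H) (char_monomial p \<alpha>))\<^sup>2) * (\<Sum>\<alpha>\<in>\<Lambda>. (c \<alpha>)\<^sup>2)"
    by (rule Cauchy_Schwarz_ineq_sum)
  also have "(\<Sum>\<alpha>\<in>\<Lambda>. (measure_pmf.expectation (planted n p k H) (char_monomial p \<alpha>))\<^sup>2) =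
    (\<Sum>\<alpha>\<in>\<Lambda>. ((1 - p) / p) ^ card \<alpha> * (card (containing k n H \<alpha>) / card (injections k n))\<^sup>2)"
  proof (rule sum.cong[OF refl])
    fix \<alpha> assume "\<alpha> \<in> \<Lambda>"
    have "(sqrt ((1 - p) / p) ^ card \<alpha>)\<^sup>2 = ((1 - p) / p) ^ card \<alpha>"
      using p by (metis power_even_abs_numeral power_mult mult.commute real_sqrt_pow2 divide_nonneg_pos diff_ge_0_iff_ge less_imp_le)
    then show "(measure_pmf.expectation (planted n p k H) (char_monomial p \<alpha>))\<^sup>2 =
      ((1 - p) / p) ^ card \<alpha> * (card (containing k n H \<alpha>) / card (injections k n))\<^sup>2"
      using expectation_planted_char_monomial[OF p \<Lambda>(1)[OF \<open>\<alpha> \<in> \<Lambda>\<close>] k] by (simp add: power_mult_distrib power_divide)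
  qed
  finally show ?thesis unfolding V \<Lambda>_def .
qed

section \<open>Copies of a graph containing a given edge set\<close>

definition neighbours :: "graph \<Rightarrow> nat \<Rightarrow> nat set" where
  "neighbours K x = {y. K {x, y}}"

lemma graphsD: "H \<in> graphs k \<Longrightarrow> H e \<Longrightarrow> e \<subseteq> {1..k} \<and> card e = 2"
  by (auto simp: graphs_def pairs_def)

lemma edges_subset: "H \<in> graphs k \<Longrightarrow> Collect H \<subseteq> pairs k"
  by (auto simp: graphs_def)

lemma neighbours_subset:
  assumes "H \<in> graphs k"
  shows "neighbours H x \<subseteq> {1..k} - {x}"
proof
  fix y assume "y \<in> neighbours H x"
  then have "{x, y} \<subseteq> {1..k} \<and> card {x, y} = 2" by (intro graphsD[OF assms]) (simp add: neighbours_def)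
  then show "y \<in> {1..k} - {x}" by auto
qed

lemma finite_neighbours: "H \<in> graphs k \<Longrightarrow> finite (neighbours H x)"
  by (rule finite_subset[OF neighbours_subset]) simp_all

lemma card_edges_le:
  assumes "H \<in> graphs k" "\<And>x. real (card (neighbours H x)) \<le> \<Delta>"
  shows "real (card (Collect H)) \<le> real k * \<Delta>"
proof -
  have "Collect H \<subseteq> (\<Union>x\<in>{1..k}. (\<lambda>y. {x, y}) ` neighbours H x)"
  proof
    fix e assume "e \<in> Collect H"
    then have e: "H e" "e \<subseteq> {1..k}" "card e = 2" using graphsD[OF assms(1)] by auto
    then obtain x y where "e = {x, y}" by (auto simp: card_2_iff)
    with e show "e \<in> (\<Union>x\<in>{1..k}. (\<lambda>y. {x, y}) ` neighbours H x)"
      by (auto simp: neighbours_def)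
  qed
  then have "card (Collect H) \<le> card (\<Union>x\<in>{1..k}. (\<lambda>y. {x, y}) ` neighbours H x)"
    using finite_neighbours[OF assms(1)] by (intro card_mono) auto
  also have "\<dots> \<le> (\<Sum>x\<in>{1..k}. card ((\<lambda>y. {x, y}) ` neighbours H x))"
    by (rule card_UN_le) simp
  also have "\<dots> \<le> (\<Sum>x\<in>{1..k}. card (neighbours H x))"
    using finite_neighbours[OF assms(1)] by (intro sum_mono card_image_le)
  finally have "real (card (Collect H)) \<le> (\<Sum>x\<in>{1..k}. real (card (neighbours H x)))"
    by (metis of_nat_mono of_nat_sum)
  also have "\<dots> \<le> (\<Sum>x\<in>{1..k}. \<Delta>)" using assms(2) by (intro sum_mono)
  finally show ?thesis by simp
qed

lemma injectionsD:
  assumes "\<phi> \<in> injections k n"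
  shows "inj_on \<phi> {1..k}" "\<phi> ` {1..k} \<subseteq> {1..n}" "\<phi> \<in> extensional {1..k}"
  using assms by (auto simp: injections_def PiE_def)

lemma edges_graph_image: "Collect (graph_image \<phi> H) = (`) \<phi> ` Collect H"
  by (auto simp: graph_image_def)

lemma graph_image_in_graphs:
  assumes "\<phi> \<in> injections k n" "H \<in> graphs k"
  shows "graph_image \<phi> H \<in> graphs n"
proof -
  have "\<phi> ` e \<in> pairs n" if "H e" for e
    using graphsD[OF assms(2) that] injectionsD[OF assms(1)]
    by (auto simp: pairs_def card_image inj_on_subset)
  then show ?thesis by (auto simp: graphs_def graph_image_def)
qed

lemma card_edges_graph_image:
  assumes "\<phi> \<in> injections k n" "H \<in> graphs k"
  shows "card (Collect (graph_image \<phi> H)) = card (Collect H)"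
  unfolding edges_graph_image
proof (rule card_image)
  show "inj_on ((`) \<phi>) (Collect H)"
    by (rule inj_on_subset[OF inj_on_image_Pow[OF injectionsD(1)[OF assms(1)]]])
       (use graphsD[OF assms(2)] in auto)
qed

text \<open>
  A vertex hit by the injection has a unique preimage, whose neighbours are carried to the
  neighbours of the image; a vertex that is missed is isolated.
\<close>

lemma card_neighbours_graph_image:
  assumes "\<phi> \<in> injections k n" "H \<in> graphs k" "\<And>x. real (card (neighbours H x)) \<le> \<Delta>"
  shows "real (card (neighbours (graph_image \<phi> H) x)) \<le> \<Delta>"
proof (cases "neighbours (graph_image \<phi> H) x = {}")
  case True
  then show ?thesis using assms(3)[of 0] by simp
next
  case False
  have ends: "\<exists>a b. H {a, b} \<and> x = \<phi> a \<and> y = \<phi> b \<and> a \<in> {1..k}"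
    if "graph_image \<phi> H {x, y}" for y
  proof -
    obtain e where e: "H e" "{x, y} = \<phi> ` e" using \<open>graph_image \<phi> H {x, y}\<close> by (auto simp: graph_image_def)
    have e2: "e \<subseteq> {1..k}" "card e = 2" using graphsD[OF assms(2) e(1)] by auto
    then obtain a b where "e = {a, b}" by (auto simp: card_2_iff)
    with e e2 have "{x, y} = {\<phi> a, \<phi> b}" "H {a, b}" "H {b, a}" "a \<in> {1..k}" "b \<in> {1..k}"
      by (auto simp: insert_commute)
    then show ?thesis by (metis doubleton_eq_iff)
  qed
  obtain a where a: "x = \<phi> a" "a \<in> {1..k}" using False ends by (auto simp: neighbours_def)
  have "neighbours (graph_image \<phi> H) x \<subseteq> \<phi> ` neighbours H a"
  proof
    fix y assume "y \<in> neighbours (graph_image \<phi> H) x"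
    then obtain a' b where "H {a', b}" "x = \<phi> a'" "y = \<phi> b" "a' \<in> {1..k}"
      using ends[of y] unfolding neighbours_def by blast
    moreover then have "a' = a" using a inj_onD[OF injectionsD(1)[OF assms(1)], of a' a] by metis
    ultimately show "y \<in> \<phi> ` neighbours H a" unfolding neighbours_def by blast
  qed
  then have "card (neighbours (graph_image \<phi> H) x) \<le> card (neighbours H a)"
    using finite_neighbours[OF assms(2)] by (rule surj_card_le[rotated])
  then show ?thesis using assms(3)[of a] by linarith
qed

lemma finite_containing: "finite (containing k n H \<alpha>)"
  unfolding containing_def using finite_injections by simp

lemma containing_insert:
  "containing k n H (insert e \<alpha>) = {\<phi> \<in> containing k n H \<alpha>. graph_image \<phi> H e}"
  by (auto simp: containing_def)

text \<open>
  Composing with \<open>\<pi>\<close> is an injective map on the positions. Since \<open>\<pi>\<close> and \<open>\<alpha>\<close> are arbitrary, this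
  inequality is in fact an equality.
\<close>

lemma card_containing_permute:
  assumes "\<pi> permutes {1..n}" "H \<in> graphs k"
  shows "card (containing k n H \<alpha>) \<le> card (containing k n H ((`) \<pi> ` \<alpha>))"
proof (rule card_inj_on_le[where f = "\<lambda>\<phi>. restrict (\<pi> \<circ> \<phi>) {1..k}"])
  show "finite (containing k n H ((`) \<pi> ` \<alpha>))" by (rule finite_containing)
  show "inj_on (\<lambda>\<phi>. restrict (\<pi> \<circ> \<phi>) {1..k}) (containing k n H \<alpha>)"
  proof (rule inj_onI)
    fix \<phi> \<psi> assume in_c: "\<phi> \<in> containing k n H \<alpha>" "\<psi> \<in> containing k n H \<alpha>"
      and eq: "restrict (\<pi> \<circ> \<phi>) {1..k} = restrict (\<pi> \<circ> \<psi>) {1..k}"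
    have "\<phi> x = \<psi> x" if "x \<in> {1..k}" for x
      using fun_cong[OF eq, of x] that permutes_inj[OF assms(1)] by (auto dest: injD)
    then show "\<phi> = \<psi>"
      using in_c by (intro extensionalityI[of _ "{1..k}"]) (auto simp: containing_def injections_def PiE_def)
  qed
  show "(\<lambda>\<phi>. restrict (\<pi> \<circ> \<phi>) {1..k}) ` containing k n H \<alpha> \<subseteq> containing k n H ((`) \<pi> ` \<alpha>)"
  proof safe
    fix \<phi> assume \<phi>: "\<phi> \<in> containing k n H \<alpha>"
    let ?\<psi> = "restrict (\<pi> \<circ> \<phi>) {1..k}"
    have inj: "\<phi> \<in> injections k n" using \<phi> by (simp add: containing_def)
    have "inj_on (\<pi> \<circ> \<phi>) {1..k}"
      using injectionsD(1)[OF inj] permutes_inj[OF assms(1)] by (auto intro: comp_inj_on inj_on_subset)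
    then have "?\<psi> \<in> injections k n"
      using injectionsD(2)[OF inj] permutes_in_image[OF assms(1)] unfolding injections_def by auto
    moreover have "graph_image ?\<psi> H (\<pi> ` e)" if e: "e \<in> \<alpha>" for e
    proof -
      obtain e' where e': "H e'" "e = \<phi> ` e'" using \<phi> e by (auto simp: containing_def graph_image_def)
      then have "\<pi> ` e = ?\<psi> ` e'"
        using graphsD[OF assms(2) e'(1)] by (auto simp: image_image subset_iff intro!: image_cong)
      then show ?thesis using e' by (auto simp: graph_image_def)
    qed
    ultimately show "?\<psi> \<in> containing k n H ((`) \<pi> ` \<alpha>)" by (auto simp: containing_def)
  qed
qed

text \<open>
  Double counting of the pairs of a position whose copy contains \<open>\<alpha>\<close> and an edge of \<open>R\<close> in that
  copy. In the applications all \<open>e' \<in> R\<close> are equivalent to \<open>e\<close> under a permutation fixing \<open>\<alpha>\<close>,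
  so the hypothesis on \<open>R\<close> holds by symmetry.
\<close>

lemma card_containing_insert_average:
  assumes "finite R" "\<And>e'. e' \<in> R \<Longrightarrow> card (containing k n H (insert e \<alpha>)) \<le> card (containing k n H (insert e' \<alpha>))"
    and "\<And>\<phi>. \<phi> \<in> injections k n \<Longrightarrow> real (card {e' \<in> R. graph_image \<phi> H e'}) \<le> M"
  shows "real (card R) * real (card (containing k n H (insert e \<alpha>))) \<le> M * real (card (containing k n H \<alpha>))"
proof -
  let ?C = "containing k n H"
  have "real (card R) * real (card (?C (insert e \<alpha>))) = (\<Sum>e'\<in>R. real (card (?C (insert e \<alpha>))))"
    by simp
  also have "\<dots> \<le> (\<Sum>e'\<in>R. real (card (?C (insert e' \<alpha>))))"
    using assms(2) by (intro sum_mono) simp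
  also have "\<dots> = (\<Sum>e'\<in>R. \<Sum>\<phi>\<in>?C \<alpha>. of_bool (graph_image \<phi> H e'))"
    unfolding containing_insert using finite_containing by (simp add: Int_def)
  also have "\<dots> = (\<Sum>\<phi>\<in>?C \<alpha>. \<Sum>e'\<in>R. of_bool (graph_image \<phi> H e'))"
    by (rule sum.swap)
  also have "\<dots> = (\<Sum>\<phi>\<in>?C \<alpha>. real (card {e' \<in> R. graph_image \<phi> H e'}))"
    using assms(1) by (simp add: Int_def)
  also have "\<dots> \<le> (\<Sum>\<phi>\<in>?C \<alpha>. M)"
    using assms(3) by (intro sum_mono) (auto simp: containing_def)
  finally show ?thesis by (simp add: mult.commute)
qed

lemma card_containing_insert_eq:
  assumes "\<pi> permutes {1..n}" "H \<in> graphs k" "\<And>x. x \<in> \<Union>\<alpha> \<Longrightarrow> \<pi> x = x"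
  shows "card (containing k n H (insert e \<alpha>)) \<le> card (containing k n H (insert (\<pi> ` e) \<alpha>))"
proof -
  have "\<pi> ` e' = e'" if "e' \<in> \<alpha>" for e'
    using assms(3) that by (force simp: image_iff)
  then have "(`) \<pi> ` insert e \<alpha> = insert (\<pi> ` e) \<alpha>" by auto
  then show ?thesis using card_containing_permute[OF assms(1,2), of "insert e \<alpha>"] by simp
qed

text \<open>
  An averaging bound \<open>f \<le> MN/|R|\<close> at every point of \<open>R\<close> makes the sum of squares as small as
  \<open>(MN)\<^sup>2/|R|\<close>; it is this gain of a factor \<open>|R|\<close> that produces the threshold.
\<close>

lemma square_sum_le_of_average:
  fixes N M c :: real
  assumes "finite R" "\<And>e. e \<in> R \<Longrightarrow> 0 \<le> f e \<and> real (card R) * f e \<le> M * N" "0 < c" "c \<le> real (card R)"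
  shows "(\<Sum>e\<in>R. (f e)\<^sup>2) \<le> (M * N)\<^sup>2 / c"
proof -
  let ?r = "real (card R)"
  have r: "?r > 0" using assms by linarith
  have "(\<Sum>e\<in>R. (f e)\<^sup>2) \<le> (\<Sum>e\<in>R. (M * N / ?r)\<^sup>2)"
    using assms(2) r by (intro sum_mono power_mono) (auto simp: field_simps)
  also have "\<dots> = (M * N)\<^sup>2 / ?r" using r by (simp add: power2_eq_square)
  also have "\<dots> \<le> (M * N)\<^sup>2 / c" using assms(3,4) r by (intro divide_left_mono) auto
  finally show ?thesis .
qed

text \<open>
  Any two edges avoiding the vertices of \<open>\<alpha>\<close> are exchanged by a permutation fixing those vertices,
  and a copy of \<open>H\<close> has \<open>|E(H)|\<close> edges in total.
\<close>

lemma sum_containing_insert_disjoint: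
  assumes "H \<in> graphs k" "\<alpha> \<subseteq> pairs n" "real (card (Collect H)) \<le> M"
    and "0 < c" "c \<le> real ((n - card (\<Union>\<alpha>)) choose 2)"
  shows "(\<Sum>e | e \<in> pairs n \<and> e \<inter> \<Union>\<alpha> = {}. (real (card (containing k n H (insert e \<alpha>))))\<^sup>2)
    \<le> (M * real (card (containing k n H \<alpha>)))\<^sup>2 / c"
proof (rule square_sum_le_of_average)
  define V where "V = \<Union>\<alpha>"
  have V: "V \<subseteq> {1..n}" using assms(2) by (auto simp: V_def pairs_def)
  let ?R = "{e \<in> pairs n. e \<inter> V = {}}"
  show fin: "finite {e \<in> pairs n. e \<inter> \<Union>\<alpha> = {}}" using finite_pairs by simp
  have "?R = {e. e \<subseteq> {1..n} - V \<and> card e = 2}" by (auto simp: pairs_def)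
  then have "card ?R = (n - card V) choose 2"
    using V by (simp add: n_subsets card_Diff_subset finite_subset)
  then show "c \<le> real (card {e \<in> pairs n. e \<inter> \<Union>\<alpha> = {}})" using assms(5) by (simp add: V_def)
  show "0 < c" by fact
  fix e assume e: "e \<in> {e \<in> pairs n. e \<inter> \<Union>\<alpha> = {}}"
  have "real (card ?R) * real (card (containing k n H (insert e \<alpha>))) \<le> M * real (card (containing k n H \<alpha>))"
  proof (rule card_containing_insert_average)
    show "finite ?R" using finite_pairs by simp
    fix e' assume e': "e' \<in> ?R"
    obtain x y where xy: "e = {x, y}" "x \<noteq> y" "x \<in> {1..n} - V" "y \<in> {1..n} - V"
      using e by (auto simp: pairs_def V_def card_2_iff)
    obtain x' y' where xy': "e' = {x', y'}" "x' \<noteq> y'" "x' \<in> {1..n} - V" "y' \<in> {1..n} - V"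
      using e' by (auto simp: pairs_def card_2_iff)
    \<comment> \<open>Move \<open>x\<close> to \<open>x'\<close> first; then the second transposition no longer touches \<open>x'\<close>.\<close>
    define z where "z = Transposition.transpose x x' y"
    define \<pi> where "\<pi> = Transposition.transpose z y' \<circ> Transposition.transpose x x'"
    have z: "z \<in> {1..n} - V" "z \<noteq> x'" using xy xy' by (auto simp: z_def Transposition.transpose_def)
    have "\<pi> permutes {1..n}"
      unfolding \<pi>_def using xy xy' z by (intro permutes_compose permutes_swap_id) auto
    moreover have "\<pi> v = v" if "v \<in> \<Union>\<alpha>" for v
      using that z xy xy' by (auto simp: \<pi>_def V_def Transposition.transpose_def)
    moreover have "\<pi> ` e = e'"
      using z xy xy' by (simp add: \<pi>_def z_def[symmetric])
    ultimately show "card (containing k n H (insert e \<alpha>)) \<le> card (containing k n H (insert e' \<alpha>))"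
      using card_containing_insert_eq[OF _ assms(1)] by metis
  next
    fix \<phi> assume \<phi>: "\<phi> \<in> injections k n"
    have "finite (Collect (graph_image \<phi> H))"
      using graph_image_in_graphs[OF \<phi> assms(1)] edges_subset finite_pairs finite_subset by metis
    then have "card {e' \<in> ?R. graph_image \<phi> H e'} \<le> card (Collect (graph_image \<phi> H))"
      by (intro card_mono) auto
    then show "real (card {e' \<in> ?R. graph_image \<phi> H e'}) \<le> M"
      using card_edges_graph_image[OF \<phi> assms(1)] assms(3) by simp
  qed
  then show "0 \<le> real (card (containing k n H (insert e \<alpha>))) \<and>
     real (card {e \<in> pairs n. e \<inter> \<Union>\<alpha> = {}}) * real (card (containing k n H (insert e \<alpha>)))
       \<le> M * real (card (containing k n H \<alpha>))"
    by (simp add: V_def)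
qed

text \<open>
  Two edges from \<open>x\<close> to vertices outside \<open>\<alpha>\<close> are exchanged by a single transposition, and a copy of
  \<open>H\<close> has at most \<open>\<Delta>\<close> edges at \<open>x\<close>.
\<close>

lemma sum_containing_insert_pendant:
  assumes "H \<in> graphs k" "\<alpha> \<subseteq> pairs n" "\<And>x. real (card (neighbours H x)) \<le> \<Delta>"
    and "x \<in> \<Union>\<alpha>" "0 < c" "c \<le> real (n - card (\<Union>\<alpha>))"
  shows "(\<Sum>e | e \<in> pairs n \<and> e \<inter> \<Union>\<alpha> = {x}. (real (card (containing k n H (insert e \<alpha>))))\<^sup>2)
    \<le> (\<Delta> * real (card (containing k n H \<alpha>)))\<^sup>2 / c"
proof (rule square_sum_le_of_average)
  define V where "V = \<Union>\<alpha>"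
  have V: "V \<subseteq> {1..n}" using assms(2) by (auto simp: V_def pairs_def)
  have x: "x \<in> V" using assms(4) by (simp add: V_def)
  let ?R = "{e \<in> pairs n. e \<inter> V = {x}}"
  show fin: "finite {e \<in> pairs n. e \<inter> \<Union>\<alpha> = {x}}" using finite_pairs by simp
  have R: "?R = (\<lambda>y. {x, y}) ` ({1..n} - V)"
  proof (intro equalityI subsetI)
    fix e assume e: "e \<in> ?R"
    then have "x \<in> e" "card e = 2" "finite e"
      by (auto simp: pairs_def intro: card_ge_0_finite)
    then have "card (e - {x}) = 1" by simp
    then obtain y where "e - {x} = {y}" by (auto simp: card_1_singleton_iff)
    then have xy: "e = {x, y}" "y \<noteq> x" "y \<in> e" using \<open>x \<in> e\<close> by auto
    have "y \<in> {1..n}" using e xy(3) unfolding pairs_def by blast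
    moreover have "y \<notin> V" using e xy(2,3) by blast
    ultimately show "e \<in> (\<lambda>y. {x, y}) ` ({1..n} - V)" using xy(1) by blast
  qed (use x V in \<open>auto simp: pairs_def card_2_iff\<close>)
  have "card ?R = n - card V"
    unfolding R using V by (subst card_image) (auto simp: inj_on_def doubleton_eq_iff card_Diff_subset finite_subset)
  then show "c \<le> real (card {e \<in> pairs n. e \<inter> \<Union>\<alpha> = {x}})" using assms(6) by (simp add: V_def)
  show "0 < c" by fact
  fix e assume e: "e \<in> {e \<in> pairs n. e \<inter> \<Union>\<alpha> = {x}}"
  have "real (card ?R) * real (card (containing k n H (insert e \<alpha>))) \<le> \<Delta> * real (card (containing k n H \<alpha>))"
  proof (rule card_containing_insert_average)
    show "finite ?R" using finite_pairs by simp
    fix e' assume e': "e' \<in> ?R"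
    have "e \<in> ?R" using e by (simp add: V_def)
    then obtain y where y: "e = {x, y}" "y \<in> {1..n} - V" unfolding R by auto
    obtain y' where y': "e' = {x, y'}" "y' \<in> {1..n} - V" using e' unfolding R by auto
    have "Transposition.transpose y y' permutes {1..n}" using y y' by (intro permutes_swap_id) auto
    moreover have "Transposition.transpose y y' v = v" if "v \<in> \<Union>\<alpha>" for v
      using that y y' by (auto simp: V_def Transposition.transpose_def)
    moreover have "Transposition.transpose y y' ` e = e'"
      using x y y' by (auto simp: Transposition.transpose_def)
    ultimately show "card (containing k n H (insert e \<alpha>)) \<le> card (containing k n H (insert e' \<alpha>))"
      using card_containing_insert_eq[OF _ assms(1)] by metis
  next
    fix \<phi> assume \<phi>: "\<phi> \<in> injections k n"
    have "{e' \<in> ?R. graph_image \<phi> H e'} \<subseteq> (\<lambda>y. {x, y}) ` neighbours (graph_image \<phi> H) x"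
      unfolding R by (auto simp: neighbours_def)
    then have "card {e' \<in> ?R. graph_image \<phi> H e'} \<le> card (neighbours (graph_image \<phi> H) x)"
      using finite_neighbours[OF graph_image_in_graphs[OF \<phi> assms(1)]] by (rule surj_card_le[rotated])
    then show "real (card {e' \<in> ?R. graph_image \<phi> H e'}) \<le> \<Delta>"
      using card_neighbours_graph_image[OF \<phi> assms(1,3), of x] by linarith
  qed
  then show "0 \<le> real (card (containing k n H (insert e \<alpha>))) \<and>
     real (card {e \<in> pairs n. e \<inter> \<Union>\<alpha> = {x}}) * real (card (containing k n H (insert e \<alpha>)))
       \<le> \<Delta> * real (card (containing k n H \<alpha>))"
    by (simp add: V_def)
qed

text \<open>
  Adding an edge never increases the count, and few edges have both ends among the vertices of \<open>\<alpha>\<close>.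
\<close>

lemma sum_containing_insert_inside:
  assumes "\<alpha> \<subseteq> pairs n"
  shows "(\<Sum>e | e \<in> pairs n \<and> e \<subseteq> \<Union>\<alpha>. (real (card (containing k n H (insert e \<alpha>))))\<^sup>2)
    \<le> (real (card (\<Union>\<alpha>)))\<^sup>2 * (real (card (containing k n H \<alpha>)))\<^sup>2"
proof -
  define V where "V = \<Union>\<alpha>"
  have V: "V \<subseteq> {1..n}" using assms by (auto simp: V_def pairs_def)
  then have finV: "finite V" by (rule finite_subset) simp
  have sub: "{e \<in> pairs n. e \<subseteq> V} \<subseteq> (\<lambda>(x, y). {x, y}) ` (V \<times> V)"
    by (auto simp: pairs_def card_2_iff)
  have "card {e \<in> pairs n. e \<subseteq> V} \<le> card (V \<times> V)"
    using sub finV by (intro surj_card_le[of "V \<times> V"]) auto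
  then have card: "real (card {e \<in> pairs n. e \<subseteq> V}) \<le> (real (card V))\<^sup>2"
    by (simp add: card_cartesian_product power2_eq_square flip: of_nat_mult)
  have "(\<Sum>e | e \<in> pairs n \<and> e \<subseteq> V. (real (card (containing k n H (insert e \<alpha>))))\<^sup>2)
    \<le> (\<Sum>e | e \<in> pairs n \<and> e \<subseteq> V. (real (card (containing k n H \<alpha>)))\<^sup>2)"
    using finite_containing by (intro sum_mono power_mono) (auto simp: containing_insert intro!: card_mono)
  also have "\<dots> \<le> (real (card V))\<^sup>2 * (real (card (containing k n H \<alpha>)))\<^sup>2"
    using card by (simp add: mult_right_mono)
  finally show ?thesis unfolding V_def .
qed

lemma card_Union_pairs_le:
  assumes "\<alpha> \<subseteq> pairs n"
  shows "card (\<Union>\<alpha>) \<le> 2 * card \<alpha>"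
proof -
  have fin: "finite \<alpha>" using assms finite_pairs finite_subset by blast
  have "card (\<Union>\<alpha>) \<le> (\<Sum>e\<in>\<alpha>. card e)" using card_UN_le[OF fin, of id] by simp
  also have "\<dots> = (\<Sum>e\<in>\<alpha>. 2)" using assms by (intro sum.cong) (auto simp: pairs_def)
  finally show ?thesis by simp
qed

text \<open>
  The three kinds of new edges together. The lower bound on \<open>n\<close> ensures that, after removing the at
  most \<open>2D\<close> vertices of \<open>\<alpha>\<close>, at least \<open>n/2\<close> vertices and \<open>n\<^sup>2/16\<close> pairs remain.
\<close>

lemma sum_containing_insert:
  assumes H: "H \<in> graphs k" and \<alpha>: "\<alpha> \<subseteq> pairs n" "card \<alpha> \<le> D"
    and deg: "\<And>x. real (card (neighbours H x)) \<le> \<Delta>" and n: "4 * D + 4 \<le> n"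
  shows "(\<Sum>e\<in>pairs n. (real (card (containing k n H (insert e \<alpha>))))\<^sup>2)
    \<le> (16 * (real k * \<Delta>)\<^sup>2 / (real n)\<^sup>2 + 4 * real D * \<Delta>\<^sup>2 / real n + 4 * (real D)\<^sup>2)
       * (real (card (containing k n H \<alpha>)))\<^sup>2"
proof -
  define V where "V = \<Union>\<alpha>"
  define N where "N = real (card (containing k n H \<alpha>))"
  define f where "f e = (real (card (containing k n H (insert e \<alpha>))))\<^sup>2" for e
  have V: "V \<subseteq> {1..n}" using \<alpha> by (auto simp: V_def pairs_def)
  then have finV: "finite V" by (rule finite_subset) simp
  have cV: "card V \<le> 2 * D" using card_Union_pairs_le[OF \<alpha>(1)] \<alpha>(2) by (simp add: V_def)
  have n0: "real n > 0" "real n \<ge> 4" using n by auto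
  have nV: "real n / 2 \<le> real (n - card V)" using cV n by linarith
  have "real n / 2 * (real n / 4) \<le> real (n - card V) * real (n - card V - 1)"
    using cV n by (intro mult_mono) linarith+
  also have "\<dots> = 2 * real ((n - card V) choose 2)"
  proof -
    have "2 * (m choose 2) = m * (m - 1)" for m :: nat
      unfolding choose_two by (rule dvd_mult_div_cancel) auto
    from this[of "n - card V"] show ?thesis by (metis of_nat_mult of_nat_numeral)
  qed
  finally have n2: "(real n)\<^sup>2 / 16 \<le> real ((n - card V) choose 2)"
    by (simp add: power2_eq_square)
  have union: "sum f (A \<union> B) \<le> sum f A + sum f B" if "finite A" "finite B" for A B
    using sum.union_inter[OF that, of f] sum_nonneg[of "A \<inter> B" f] by (simp add: f_def)
  have "pairs n \<subseteq> {e \<in> pairs n. e \<inter> V = {}} \<union> ((\<Union>x\<in>V. {e \<in> pairs n. e \<inter> V = {x}}) \<union> {e \<in> pairs n. e \<subseteq> V})"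
  proof
    fix e assume e: "e \<in> pairs n"
    then obtain a b where "e = {a, b}" by (auto simp: pairs_def card_2_iff)
    with e show "e \<in> {e \<in> pairs n. e \<inter> V = {}} \<union> ((\<Union>x\<in>V. {e \<in> pairs n. e \<inter> V = {x}}) \<union> {e \<in> pairs n. e \<subseteq> V})"
      by (cases "a \<in> V"; cases "b \<in> V") auto
  qed
  then have "sum f (pairs n) \<le> sum f ({e \<in> pairs n. e \<inter> V = {}} \<union> ((\<Union>x\<in>V. {e \<in> pairs n. e \<inter> V = {x}}) \<union> {e \<in> pairs n. e \<subseteq> V}))"
    using finite_pairs finV by (intro sum_mono2) (auto simp: f_def)
  also have "\<dots> \<le> sum f {e \<in> pairs n. e \<inter> V = {}} + sum f ((\<Union>x\<in>V. {e \<in> pairs n. e \<inter> V = {x}}) \<union> {e \<in> pairs n. e \<subseteq> V})"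
    using finite_pairs finV by (intro union) auto
  also have "sum f ((\<Union>x\<in>V. {e \<in> pairs n. e \<inter> V = {x}}) \<union> {e \<in> pairs n. e \<subseteq> V}) \<le>
      sum f (\<Union>x\<in>V. {e \<in> pairs n. e \<inter> V = {x}}) + sum f {e \<in> pairs n. e \<subseteq> V}"
    using finite_pairs finV by (intro union) auto
  also have "sum f (\<Union>x\<in>V. {e \<in> pairs n. e \<inter> V = {x}}) = (\<Sum>x\<in>V. sum f {e \<in> pairs n. e \<inter> V = {x}})"
    using finV finite_pairs by (intro sum.UNION_disjoint) auto
  also have "sum f {e \<in> pairs n. e \<inter> V = {}} \<le> (real k * \<Delta> * N)\<^sup>2 / ((real n)\<^sup>2 / 16)"
    unfolding f_def N_def V_def
    using n0 n2 by (intro sum_containing_insert_disjoint[OF H \<alpha>(1) card_edges_le[OF H deg]]) (auto simp: V_def)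
  also have "(\<Sum>x\<in>V. sum f {e \<in> pairs n. e \<inter> V = {x}}) \<le> (\<Sum>x\<in>V. (\<Delta> * N)\<^sup>2 / (real n / 2))"
    unfolding f_def N_def V_def
    using n0 nV by (intro sum_mono sum_containing_insert_pendant[OF H \<alpha>(1) deg]) (auto simp: V_def)
  also have "\<dots> \<le> (2 * real D) * ((\<Delta> * N)\<^sup>2 / (real n / 2))"
    using cV n0 by (simp only: sum_constant) (intro mult_right_mono, auto)
  also have "sum f {e \<in> pairs n. e \<subseteq> V} \<le> (real (card V))\<^sup>2 * N\<^sup>2"
    unfolding f_def N_def V_def by (rule sum_containing_insert_inside[OF \<alpha>(1)])
  also have "\<dots> \<le> (2 * real D)\<^sup>2 * N\<^sup>2"
    using cV by (intro mult_right_mono power_mono) auto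
  finally have "sum f (pairs n) \<le> (real k * \<Delta> * N)\<^sup>2 / ((real n)\<^sup>2 / 16) +
      ((2 * real D) * ((\<Delta> * N)\<^sup>2 / (real n / 2)) + (2 * real D)\<^sup>2 * N\<^sup>2)" by simp
  also have "\<dots> = (16 * (real k * \<Delta>)\<^sup>2 / (real n)\<^sup>2 + 4 * real D * \<Delta>\<^sup>2 / real n + 4 * (real D)\<^sup>2) * N\<^sup>2"
    using n0 by (simp add: field_simps power2_eq_square)
  finally show ?thesis unfolding f_def N_def .
qed

text \<open>
  Induction on the number of edges: every set of \<open>j + 1\<close> edges arises, at least once, by adding an
  edge to a set of \<open>j\<close> edges.
\<close>

lemma sum_containing_power_bound:
  assumes H: "H \<in> graphs k" and k: "k \<le> n"
    and deg: "\<And>x. real (card (neighbours H x)) \<le> \<Delta>" and n: "4 * D + 4 \<le> n" and \<theta>: "0 \<le> \<theta>"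
    and L: "\<theta> * (16 * (real k * \<Delta>)\<^sup>2 / (real n)\<^sup>2 + 4 * real D * \<Delta>\<^sup>2 / real n + 4 * (real D)\<^sup>2) \<le> L"
    and j: "j \<le> D"
  shows "(\<Sum>\<alpha> | \<alpha> \<subseteq> pairs n \<and> card \<alpha> = j.
       \<theta> ^ j * (real (card (containing k n H \<alpha>)) / real (card (injections k n)))\<^sup>2) \<le> L ^ j"
  using j
proof (induction j)
  case 0
  have "{\<alpha>. \<alpha> \<subseteq> pairs n \<and> card \<alpha> = 0} = {{}}"
    using finite_pairs finite_subset by (auto simp: card_eq_0_iff)
  then show ?case by (simp add: containing_def)
next
  case (Suc j)
  define w where "w \<alpha> = (real (card (containing k n H \<alpha>)) / real (card (injections k n)))\<^sup>2" for \<alpha>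
  define A where "A i = {\<alpha>. \<alpha> \<subseteq> pairs n \<and> card \<alpha> = i}" for i
  define B where "B = 16 * (real k * \<Delta>)\<^sup>2 / (real n)\<^sup>2 + 4 * real D * \<Delta>\<^sup>2 / real n + 4 * (real D)\<^sup>2"
  have finA: "finite (A i)" for i unfolding A_def using finite_pairs by simp
  have B0: "0 \<le> B" unfolding B_def by simp
  have w: "(\<Sum>e\<in>pairs n. w (insert e \<alpha>)) \<le> B * w \<alpha>" if "\<alpha> \<in> A j" for \<alpha>
  proof -
    have "(\<Sum>e\<in>pairs n. w (insert e \<alpha>)) =
        (\<Sum>e\<in>pairs n. (real (card (containing k n H (insert e \<alpha>))))\<^sup>2) / (real (card (injections k n)))\<^sup>2"
      by (simp add: w_def power_divide sum_divide_distrib)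
    also have "\<dots> \<le> (B * (real (card (containing k n H \<alpha>)))\<^sup>2) / (real (card (injections k n)))\<^sup>2"
      unfolding B_def using that Suc.prems
      by (intro divide_right_mono sum_containing_insert[OF H _ _ deg n]) (auto simp: A_def)
    finally show ?thesis by (simp add: w_def power_divide)
  qed
  have sub: "A (Suc j) \<subseteq> (\<lambda>(\<alpha>, e). insert e \<alpha>) ` (A j \<times> pairs n)"
  proof
    fix \<beta> assume \<beta>: "\<beta> \<in> A (Suc j)"
    then obtain e \<alpha> where "\<beta> = insert e \<alpha>" "e \<notin> \<alpha>" "card \<alpha> = j"
      by (auto simp: A_def card_Suc_eq)
    with \<beta> show "\<beta> \<in> (\<lambda>(\<alpha>, e). insert e \<alpha>) ` (A j \<times> pairs n)"
      by (auto simp: A_def intro!: image_eqI[of _ _ "(\<alpha>, e)"])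
  qed
  have "sum w (A (Suc j)) \<le> sum w ((\<lambda>(\<alpha>, e). insert e \<alpha>) ` (A j \<times> pairs n))"
    using sub finA finite_pairs by (intro sum_mono2) (auto simp: w_def)
  also have "\<dots> \<le> sum (w \<circ> (\<lambda>(\<alpha>, e). insert e \<alpha>)) (A j \<times> pairs n)"
    using finA finite_pairs by (intro sum_image_le) (auto simp: w_def)
  also have "\<dots> = (\<Sum>\<alpha>\<in>A j. \<Sum>e\<in>pairs n. w (insert e \<alpha>))"
    by (simp add: sum.cartesian_product case_prod_unfold comp_def)
  also have "\<dots> \<le> (\<Sum>\<alpha>\<in>A j. B * w \<alpha>)" by (rule sum_mono[OF w])
  finally have "\<theta> ^ Suc j * sum w (A (Suc j)) \<le> \<theta> ^ Suc j * (B * sum w (A j))"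
    using \<theta> by (intro mult_left_mono) (auto simp: sum_distrib_left)
  also have "\<dots> = (\<theta> * B) * (\<Sum>\<alpha>\<in>A j. \<theta> ^ j * w \<alpha>)"
    by (simp add: sum_distrib_left mult_ac)
  also have "\<dots> \<le> L * L ^ j"
  proof (rule mult_mono)
    show "\<theta> * B \<le> L" using L by (simp add: B_def)
    then show "0 \<le> L" using \<theta> B0 by (meson mult_nonneg_nonneg order_trans)
    show "(\<Sum>\<alpha>\<in>A j. \<theta> ^ j * w \<alpha>) \<le> L ^ j" using Suc by (simp add: A_def w_def)
    show "0 \<le> (\<Sum>\<alpha>\<in>A j. \<theta> ^ j * w \<alpha>)" using \<theta> by (intro sum_nonneg) (auto simp: w_def)
  qed
  finally show ?case by (simp add: A_def w_def sum_distrib_left)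
qed

lemma sum_containing_bound:
  assumes "H \<in> graphs k" "k \<le> n"
    and "\<And>x. real (card (neighbours H x)) \<le> \<Delta>" and "4 * D + 4 \<le> n" and "0 \<le> \<theta>"
    and "\<theta> * (16 * (real k * \<Delta>)\<^sup>2 / (real n)\<^sup>2 + 4 * real D * \<Delta>\<^sup>2 / real n + 4 * (real D)\<^sup>2) \<le> L"
  shows "(\<Sum>\<alpha> | \<alpha> \<subseteq> pairs n \<and> 1 \<le> card \<alpha> \<and> card \<alpha> \<le> D.
       \<theta> ^ card \<alpha> * (real (card (containing k n H \<alpha>)) / real (card (injections k n)))\<^sup>2) \<le> (\<Sum>j=1..D. L ^ j)"
proof -
  define f where "f \<alpha> = \<theta> ^ card \<alpha> * (real (card (containing k n H \<alpha>)) / real (card (injections k n)))\<^sup>2" for \<alpha>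
  have "sum f {\<alpha>. \<alpha> \<subseteq> pairs n \<and> 1 \<le> card \<alpha> \<and> card \<alpha> \<le> D} =
      (\<Sum>j=1..D. sum f {\<alpha> \<in> {\<alpha>. \<alpha> \<subseteq> pairs n \<and> 1 \<le> card \<alpha> \<and> card \<alpha> \<le> D}. card \<alpha> = j})"
    using finite_pairs by (intro sum.group[symmetric]) auto
  also have "\<dots> \<le> (\<Sum>j=1..D. L ^ j)"
  proof (rule sum_mono)
    fix j assume j: "j \<in> {1..D}"
    then have "{\<alpha> \<in> {\<alpha>. \<alpha> \<subseteq> pairs n \<and> 1 \<le> card \<alpha> \<and> card \<alpha> \<le> D}. card \<alpha> = j} = {\<alpha>. \<alpha> \<subseteq> pairs n \<and> card \<alpha> = j}"
      by auto
    then show "sum f {\<alpha> \<in> {\<alpha>. \<alpha> \<subseteq> pairs n \<and> 1 \<le> card \<alpha> \<and> card \<alpha> \<le> D}. card \<alpha> = j} \<le> L ^ j"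
      using sum_containing_power_bound[OF assms, of j] j by (simp add: f_def)
  qed
  finally show ?thesis unfolding f_def .
qed

section \<open>Degrees and edge count of a typical random graph\<close>

lemma set_erdos_renyi_subset: "set_pmf (erdos_renyi k q) \<subseteq> graphs k"
  using set_Pi_pmf_subset[OF finite_pairs, of k False "\<lambda>_. bernoulli_pmf q"]
  unfolding erdos_renyi_def graphs_def by blast

text \<open>
  Exponential Markov inequality. Taking \<open>s = 1\<close> gives upper tails and \<open>s = -1\<close> lower tails. The
  exponent is proportional to the mean \<open>q|S|\<close>, as sparse graphs require; an additive Hoeffding bound
  would be too weak for small \<open>q\<close>.
\<close>

lemma erdos_renyi_edge_count_tail:
  assumes "S \<subseteq> pairs k" "0 \<le> q" "q \<le> 1"
  shows "measure_pmf.prob (erdos_renyi k q) {G. t \<le> s * real (card {e \<in> S. G e})}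
    \<le> exp (q * real (card S) * (exp s - 1) - t)"
proof -
  let ?X = "\<lambda>G :: graph. s * real (card {e \<in> S. G e})"
  have fin: "finite S" using assms(1) finite_pairs finite_subset by blast
  have "measure_pmf.prob (erdos_renyi k q) {G. t \<le> ?X G} =
      measure_pmf.expectation (erdos_renyi k q) (indicator {G. t \<le> ?X G})"
    by simp
  also have "\<dots> \<le> measure_pmf.expectation (erdos_renyi k q) (\<lambda>G. exp (- t) * (\<Prod>e\<in>S. exp (s * of_bool (G e))))"
  proof (rule integral_mono[OF integrable_erdos_renyi integrable_erdos_renyi])
    fix G :: graph
    have "(\<Prod>e\<in>S. exp (s * of_bool (G e))) = exp (?X G)"
      using fin by (simp add: exp_sum[symmetric] sum_distrib_left[symmetric] Int_def)
    then have "exp (- t) * (\<Prod>e\<in>S. exp (s * of_bool (G e))) = exp (?X G - t)"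
      by (simp add: exp_diff exp_minus field_simps)
    then show "indicator {G. t \<le> ?X G} G \<le> exp (- t) * (\<Prod>e\<in>S. exp (s * of_bool (G e)))"
      by (auto simp: indicator_def)
  qed
  also have "\<dots> = exp (- t) * (1 + q * (exp s - 1)) ^ card S"
    using expectation_erdos_renyi_prod[OF assms, of "\<lambda>e b. exp (s * of_bool b)"]
    by (simp add: integrable_erdos_renyi algebra_simps)
  also have "\<dots> \<le> exp (- t) * exp (q * (exp s - 1)) ^ card S"
  proof (intro mult_left_mono power_mono)
    show "1 + q * (exp s - 1) \<le> exp (q * (exp s - 1))" by (rule exp_ge_add_one_self)
    have "0 \<le> (1 - q) + q * exp s" using assms by simp
    then show "0 \<le> 1 + q * (exp s - 1)" by (simp add: algebra_simps)
  qed auto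
  also have "\<dots> = exp (q * real (card S) * (exp s - 1) - t)"
    by (simp add: exp_of_nat_mult[symmetric] exp_add[symmetric] algebra_simps)
  finally show ?thesis .
qed

definition typical_graphs :: "nat \<Rightarrow> real \<Rightarrow> graph set" where
  "typical_graphs k q = {H \<in> graphs k. (\<forall>x. real (card (neighbours H x)) \<le> 4 * real k * q) \<and>
     (real k)\<^sup>2 * q / 8 \<le> real (card (Collect H))}"

text \<open>
  The degree of a vertex has mean at most \<open>kq\<close>. Since \<open>e \<le> 3\<close>, the constant \<open>4\<close>
  leaves an exponent of \<open>(4 - (e - 1)) kq \<ge> 2kq\<close>, which beats a union bound over \<open>k\<close> vertices once
  \<open>kq \<ge> log k\<close>.
\<close>

lemma degree_tail:
  assumes "0 \<le> q" "q \<le> 1"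
  shows "measure_pmf.prob (erdos_renyi k q) {G. 4 * real k * q \<le> real (card {e \<in> {e \<in> pairs k. x \<in> e}. G e})}
    \<le> exp (- (2 * real k * q))"
proof -
  let ?S = "{e \<in> pairs k. x \<in> e}"
  have "?S \<subseteq> (\<lambda>y. {x, y}) ` {1..k}"
  proof
    fix e assume e: "e \<in> ?S"
    then obtain a b where ab: "e = {a, b}" "a \<in> {1..k}" "b \<in> {1..k}" by (auto simp: pairs_def card_2_iff)
    then have "e = {x, b} \<or> e = {x, a}" using e by auto
    then show "e \<in> (\<lambda>y. {x, y}) ` {1..k}" using ab by blast
  qed
  then have "card ?S \<le> card {1..k}" by (rule surj_card_le[rotated]) simp
  then have "real (card ?S) \<le> real k" by simp
  then have "q * real (card ?S) * (exp 1 - 1) \<le> q * real k * 2"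
    using exp_le assms by (intro mult_mono) auto
  then have "exp (q * real (card ?S) * (exp 1 - 1) - 4 * real k * q) \<le> exp (- (2 * real k * q))"
    by simp
  moreover have "measure_pmf.prob (erdos_renyi k q) {G. 4 * real k * q \<le> real (card {e \<in> ?S. G e})}
    \<le> exp (q * real (card ?S) * (exp 1 - 1) - 4 * real k * q)"
    using erdos_renyi_edge_count_tail[of ?S k q "4 * real k * q" 1] assms by auto
  ultimately show ?thesis by linarith
qed

lemma card_pairs: "card (pairs n) = n choose 2"
  unfolding pairs_def by (simp add: n_subsets)

text \<open>
  The mean is at least \<open>k\<^sup>2q/4\<close>, twice the level in question. As \<open>1 - 1/e \<ge> 3/5\<close>, the tail bound
  with \<open>s = -1\<close> has exponent at least \<open>(3/5 \<cdot> 1/4 - 1/8) k\<^sup>2q = k\<^sup>2q/40\<close>.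
\<close>

lemma edge_count_tail:
  assumes "0 \<le> q" "q \<le> 1" "2 \<le> k"
  shows "measure_pmf.prob (erdos_renyi k q) {G. real (card {e \<in> pairs k. G e}) \<le> (real k)\<^sup>2 * q / 8}
    \<le> exp (- ((real k)\<^sup>2 * q / 40))"
proof -
  have "2 * real (card (pairs k)) = real k * (real k - 1)"
    unfolding card_pairs using assms(3) by (simp add: choose_two real_of_nat_div of_nat_diff)
  moreover have "real k * (real k - 1) \<ge> real k * (real k / 2)"
    using assms(3) by (intro mult_left_mono) auto
  ultimately have N: "real (card (pairs k)) \<ge> (real k)\<^sup>2 / 4"
    by (simp add: power2_eq_square)
  have "exp 1 \<ge> (5/2 :: real)" using exp_lower_Taylor_quadratic[of 1] by simp
  then have "exp (-1) \<le> (2/5 :: real)" by (simp add: exp_minus field_simps)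
  then have "q * real (card (pairs k)) * (exp (- 1) - 1) \<le> q * real (card (pairs k)) * (- (3/5))"
    using assms by (intro mult_left_mono) auto
  also have "\<dots> \<le> q * ((real k)\<^sup>2 / 4) * (- (3/5))"
    using mult_left_mono[OF N assms(1)] by linarith
  finally have "exp (q * real (card (pairs k)) * (exp (- 1) - 1) + (real k)\<^sup>2 * q / 8) \<le> exp (- ((real k)\<^sup>2 * q / 40))"
    by (simp add: algebra_simps)
  moreover have "measure_pmf.prob (erdos_renyi k q) {G. real (card {e \<in> pairs k. G e}) \<le> (real k)\<^sup>2 * q / 8}
    \<le> exp (q * real (card (pairs k)) * (exp (- 1) - 1) + (real k)\<^sup>2 * q / 8)"
    using erdos_renyi_edge_count_tail[of "pairs k" k q "- ((real k)\<^sup>2 * q / 8)" "-1"] assms by auto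
  ultimately show ?thesis by linarith
qed

lemma prob_typical_graphs:
  assumes "0 \<le> q" "q \<le> 1" "2 \<le> k"
  shows "1 - measure_pmf.prob (erdos_renyi k q) (typical_graphs k q)
    \<le> real k * exp (- (2 * real k * q)) + exp (- ((real k)\<^sup>2 * q / 40))"
proof -
  let ?P = "erdos_renyi k q"
  define U where "U x = {G. 4 * real k * q \<le> real (card {e \<in> {e \<in> pairs k. x \<in> e}. G e})}" for x :: nat
  define W where "W = {G. real (card {e \<in> pairs k. G e}) \<le> (real k)\<^sup>2 * q / 8}"
  have "- typical_graphs k q \<inter> set_pmf ?P \<subseteq> (\<Union>x\<in>{1..k}. U x) \<union> W"
  proof
    fix G assume G: "G \<in> - typical_graphs k q \<inter> set_pmf ?P"
    then have gr: "G \<in> graphs k" using set_erdos_renyi_subset by blast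
    show "G \<in> (\<Union>x\<in>{1..k}. U x) \<union> W"
    proof (cases "(real k)\<^sup>2 * q / 8 \<le> real (card (Collect G))")
      case False
      moreover have "{e \<in> pairs k. G e} = Collect G" using edges_subset[OF gr] by auto
      ultimately show ?thesis by (simp add: W_def)
    next
      case True
      then obtain x where x: "real (card (neighbours G x)) > 4 * real k * q"
        using G gr by (auto simp: typical_graphs_def not_le)
      moreover have "0 \<le> 4 * real k * q" using assms(1) by simp
      ultimately have "neighbours G x \<noteq> {}" by auto
      then obtain y where "G {x, y}" by (auto simp: neighbours_def)
      then have xk: "x \<in> {1..k}" using graphsD[OF gr, of "{x, y}"] by simp
      have "(\<lambda>y. {x, y}) ` neighbours G x \<subseteq> {e \<in> {e \<in> pairs k. x \<in> e}. G e}"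
        using edges_subset[OF gr] by (auto simp: neighbours_def)
      moreover have "inj_on (\<lambda>y. {x, y}) (neighbours G x)"
        by (auto simp: inj_on_def doubleton_eq_iff)
      ultimately have "card (neighbours G x) \<le> card {e \<in> {e \<in> pairs k. x \<in> e}. G e}"
        using finite_pairs by (metis (no_types, lifting) card_inj_on_le finite_subset mem_Collect_eq subsetI)
      then have "G \<in> U x" using x by (simp add: U_def)
      then show ?thesis using xk by blast
    qed
  qed
  then have "measure_pmf.prob ?P (- typical_graphs k q \<inter> set_pmf ?P) \<le> measure_pmf.prob ?P ((\<Union>x\<in>{1..k}. U x) \<union> W)"
    by (intro measure_pmf.finite_measure_mono) auto
  also have "\<dots> \<le> measure_pmf.prob ?P (\<Union>x\<in>{1..k}. U x) + measure_pmf.prob ?P W"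
    by (intro measure_Un_le) auto
  also have "measure_pmf.prob ?P (\<Union>x\<in>{1..k}. U x) \<le> (\<Sum>x\<in>{1..k}. measure_pmf.prob ?P (U x))"
    by (intro measure_pmf.finite_measure_subadditive_finite) auto
  also have "\<dots> \<le> (\<Sum>x\<in>{1..k}. exp (- (2 * real k * q)))"
    unfolding U_def by (intro sum_mono degree_tail assms)
  also have "measure_pmf.prob ?P W \<le> exp (- ((real k)\<^sup>2 * q / 40))"
    unfolding W_def by (rule edge_count_tail[OF assms])
  finally have "measure_pmf.prob ?P (- typical_graphs k q) \<le> real k * exp (- (2 * real k * q)) + exp (- ((real k)\<^sup>2 * q / 40))"
    by (simp add: measure_Int_set_pmf)
  then show ?thesis using measure_pmf.prob_compl[of "typical_graphs k q" ?P] by (simp add: Compl_eq_Diff_UNIV)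
qed

text \<open>
  The hypothesis \<open>kq \<gg> log k\<close> already forces \<open>k \<rightarrow> \<infinity>\<close>: the quotient is \<open>0\<close> for \<open>k \<le> 1\<close> because
  \<open>ln 0 = ln 1 = 0\<close>, and at most \<open>k / ln 2\<close> otherwise.
\<close>

lemma size_tendsto_infinity:
  fixes k :: "nat \<Rightarrow> nat" and q :: "nat \<Rightarrow> real"
  assumes "\<And>n. 0 < q n \<and> q n \<le> 1"
    and "little_omega (\<lambda>n. real (k n) * q n) (\<lambda>n. ln (real (k n)))"
  shows "filterlim (\<lambda>n. real (k n)) at_top sequentially"
proof -
  define u where "u n = real (k n) * q n / ln (real (k n))" for n
  have le: "ln 2 * u n \<le> real (k n)" for n
  proof (cases "k n \<ge> 2")
    case True
    then have l: "ln 2 \<le> ln (real (k n))" by simp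
    then have l0: "0 < ln (real (k n))" using ln_gt_zero[of "2::real"] by linarith
    have "u n \<le> real (k n) / ln (real (k n))"
      unfolding u_def using assms(1)[of n] l0
      by (intro divide_right_mono) (auto intro: mult_left_le)
    also have "\<dots> \<le> real (k n) / ln 2"
      using l l0 ln_gt_zero[of "2::real"] by (intro divide_left_mono mult_pos_pos) auto
    finally show ?thesis using ln_gt_zero[of "2::real"] by (simp add: field_simps)
  next
    case False
    then have "k n = 0 \<or> k n = 1" by auto
    then show ?thesis by (auto simp: u_def)
  qed
  have "filterlim (\<lambda>n. ln 2 * u n) at_top sequentially"
    using assms(2) unfolding little_omega_def u_def
    by (intro filterlim_tendsto_pos_mult_at_top[OF tendsto_const]) auto
  then show ?thesis by (rule filterlim_at_top_mono) (simp add: le)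
qed

lemma typical_graphs_asymptotically_almost_sure:
  fixes k :: "nat \<Rightarrow> nat" and q :: "nat \<Rightarrow> real"
  assumes q: "\<And>n. 0 < q n \<and> q n \<le> 1"
    and om: "little_omega (\<lambda>n. real (k n) * q n) (\<lambda>n. ln (real (k n)))"
  shows "(\<lambda>n. measure_pmf.prob (erdos_renyi (k n) (q n)) (typical_graphs (k n) (q n))) \<longlonglongrightarrow> 1"
proof (rule tendsto_sandwich)
  have kinf: "filterlim (\<lambda>n. real (k n)) at_top sequentially" by (rule size_tendsto_infinity[OF assms])
  have k3: "\<forall>\<^sub>F n in sequentially. real (k n) \<ge> 3" using kinf unfolding filterlim_at_top by blast
  have kq: "\<forall>\<^sub>F n in sequentially. real (k n) * q n / ln (real (k n)) \<ge> 1"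
    using om by (simp add: little_omega_def filterlim_at_top)
  show "\<forall>\<^sub>F n in sequentially. 1 - (1 / real (k n) + exp (- (real (k n) / 40)))
      \<le> measure_pmf.prob (erdos_renyi (k n) (q n)) (typical_graphs (k n) (q n))"
    using k3 kq
  proof eventually_elim
    case (elim n)
    \<comment> \<open>\<open>k \<ge> 3\<close> gives \<open>ln k \<ge> 1\<close>, hence also \<open>k\<^sup>2q \<ge> k\<close>.\<close>
    have "exp 1 \<le> real (k n)" using exp_le elim(1) by linarith
    then have l: "1 \<le> ln (real (k n))" using elim(1) by (subst ln_ge_iff) auto
    then have kql: "ln (real (k n)) \<le> real (k n) * q n" using elim(2) by (simp add: field_simps)
    have sq: "exp (2 * ln (real (k n))) = real (k n) * real (k n)"
      unfolding mult_2 exp_add using elim(1) by simp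
    have "real (k n) * exp (- (2 * real (k n) * q n)) \<le> real (k n) * exp (- (2 * ln (real (k n))))"
      using kql by (intro mult_left_mono) auto
    also have "\<dots> = 1 / real (k n)"
      unfolding exp_minus sq using elim(1) by (simp add: field_simps)
    finally have 1: "real (k n) * exp (- (2 * real (k n) * q n)) \<le> 1 / real (k n)" .
    have "real (k n) * 1 \<le> real (k n) * (real (k n) * q n)"
      using kql l by (intro mult_left_mono) auto
    then have 2: "exp (- ((real (k n))\<^sup>2 * q n / 40)) \<le> exp (- (real (k n) / 40))"
      by (simp add: power2_eq_square mult.assoc)
    have "1 - measure_pmf.prob (erdos_renyi (k n) (q n)) (typical_graphs (k n) (q n))
        \<le> real (k n) * exp (- (2 * real (k n) * q n)) + exp (- ((real (k n))\<^sup>2 * q n / 40))"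
      using q[of n] elim(1) by (intro prob_typical_graphs) auto
    then show ?case using 1 2 by linarith
  qed
  show "\<forall>\<^sub>F n in sequentially. measure_pmf.prob (erdos_renyi (k n) (q n)) (typical_graphs (k n) (q n)) \<le> 1"
    by simp
  have "((\<lambda>x :: real. 1 - (1 / x + exp (- (x / 40)))) \<longlongrightarrow> 1) at_top" by real_asymp
  from filterlim_compose[OF this kinf]
  show "(\<lambda>n. 1 - (1 / real (k n) + exp (- (real (k n) / 40)))) \<longlonglongrightarrow> 1" .
qed simp

section \<open>Boundedness of the gap below the threshold\<close>

text \<open>
  With \<open>\<Delta> = 4kq\<close> the cost of a new edge is bounded in terms of \<open>z\<close>: the term from disjoint edges is
  of order \<open>\<rho>\<^sup>2\<close>, the term from pendant edges is of order \<open>\<rho>\<close> because \<open>q\<^sup>2(1 - p) \<le> q(1 - p)\<^bsup>1/2\<^esup>\<close>,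
  and the rest is constant. The lower bound \<open>p0\<close> replaces the denominator \<open>p\<close>.
\<close>

lemma typical_graphs_gap_bound:
  assumes p0: "0 < p0" "p0 \<le> p" and p: "p < 1" and q: "0 < q" "q \<le> 1" and k: "k \<le> n"
    and H: "H \<in> typical_graphs k q" and F: "poly_vars F \<subseteq> pairs n" "total_degree F \<le> D"
    and n: "4 * D + 4 \<le> n"
    and r: "(real k)\<^sup>2 * q * sqrt (1 - p) / real n \<le> z"
  shows "(measure_pmf.expectation (planted n p k H) (eval_poly F) -
          measure_pmf.expectation (erdos_renyi n p) (eval_poly F))\<^sup>2
    \<le> (\<Sum>j=1..D. ((256 * z\<^sup>2 + 64 * real D * z + 4 * (real D)\<^sup>2) / p0) ^ j)
      * measure_pmf.variance (erdos_renyi n p) (eval_poly F)"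
proof -
  define \<Delta> where "\<Delta> = 4 * real k * q"
  define \<rho> where "\<rho> = (real k)\<^sup>2 * q * sqrt (1 - p) / real n"
  define B where "B = 16 * (real k * \<Delta>)\<^sup>2 / (real n)\<^sup>2 + 4 * real D * \<Delta>\<^sup>2 / real n + 4 * (real D)\<^sup>2"
  have p': "0 < p" using p0 by linarith
  have n0: "real n > 0" using n by simp
  have \<rho>: "0 \<le> \<rho>" "\<rho> \<le> z" using q p n0 r by (auto simp: \<rho>_def)
  have s: "(sqrt (1 - p))\<^sup>2 = 1 - p" "1 - p \<le> sqrt (1 - p)"
    using p p' by (auto intro: real_le_rsqrt simp: power2_eq_square mult_le_one mult_left_le)
  have t0: "(1 - p) * (16 * (real k * \<Delta>)\<^sup>2 / (real n)\<^sup>2) = 256 * \<rho>\<^sup>2"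
    by (simp add: \<rho>_def \<Delta>_def power_divide power_mult_distrib s)
  have "(1 - p) * (4 * real D * \<Delta>\<^sup>2 / real n) = 64 * real D * ((real k)\<^sup>2 * (q * q) * (1 - p) / real n)"
    by (simp add: \<Delta>_def power2_eq_square)
  also have "\<dots> \<le> 64 * real D * ((real k)\<^sup>2 * q * sqrt (1 - p) / real n)"
    using q n0 s(2) p by (intro mult_left_mono divide_right_mono mult_mono) (auto simp: mult_left_le)
  finally have t1: "(1 - p) * (4 * real D * \<Delta>\<^sup>2 / real n) \<le> 64 * real D * \<rho>" by (simp add: \<rho>_def)
  have t2: "(1 - p) * (4 * (real D)\<^sup>2) \<le> 1 * (4 * (real D)\<^sup>2)"
    using p' by (intro mult_right_mono) auto
  have "(1 - p) * B \<le> 256 * \<rho>\<^sup>2 + 64 * real D * \<rho> + 4 * (real D)\<^sup>2"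
    using t0 t1 t2 unfolding B_def by (simp only: distrib_left mult_1)
  also have "\<dots> \<le> 256 * z\<^sup>2 + 64 * real D * z + 4 * (real D)\<^sup>2"
    using \<rho> by (intro add_mono mult_left_mono power_mono) auto
  finally have b: "(1 - p) * B \<le> 256 * z\<^sup>2 + 64 * real D * z + 4 * (real D)\<^sup>2" .
  have "0 \<le> B" by (simp add: B_def)
  have "(1 - p) / p * B = (1 - p) * B / p" by simp
  also have "\<dots> \<le> (1 - p) * B / p0"
    using p0 p \<open>0 \<le> B\<close> by (intro divide_left_mono) auto
  also have "\<dots> \<le> (256 * z\<^sup>2 + 64 * real D * z + 4 * (real D)\<^sup>2) / p0"
    using b p0 by (intro divide_right_mono) auto
  finally have L: "(1 - p) / p * B \<le> (256 * z\<^sup>2 + 64 * real D * z + 4 * (real D)\<^sup>2) / p0" .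
  have gr: "H \<in> graphs k" "\<And>x. real (card (neighbours H x)) \<le> \<Delta>"
    using H by (auto simp: typical_graphs_def \<Delta>_def)
  have "(\<Sum>\<alpha> | \<alpha> \<subseteq> pairs n \<and> 1 \<le> card \<alpha> \<and> card \<alpha> \<le> D.
          ((1 - p) / p) ^ card \<alpha> * (card (containing k n H \<alpha>) / card (injections k n))\<^sup>2)
    \<le> (\<Sum>j=1..D. ((256 * z\<^sup>2 + 64 * real D * z + 4 * (real D)\<^sup>2) / p0) ^ j)"
    using p p' L by (intro sum_containing_bound[OF gr(1) k gr(2) n]) (auto simp: B_def)
  moreover have "0 \<le> measure_pmf.variance (erdos_renyi n p) (eval_poly F)"
    by simp
  ultimately show ?thesis
    using low_degree_gap_le_variance[OF p' p F k, of H] mult_right_mono order_trans by blast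
qed

text \<open>
  It suffices that the gap is at most a constant multiple of the null standard deviation
  infinitely often, since
  strong separation is a statement about all large \<open>n\<close>.
\<close>

lemma not_strongly_separates:
  assumes "0 \<le> A"
    and "\<exists>\<^sub>F n in sequentially. (measure_pmf.expectation (P n) (f n) - measure_pmf.expectation (Q n) (f n))\<^sup>2
       \<le> A * measure_pmf.variance (Q n) (f n)"
  shows "\<not> strongly_separates f P Q"
proof
  define d where "d n = measure_pmf.expectation (P n) (f n) - measure_pmf.expectation (Q n) (f n)" for n
  define v where "v n = measure_pmf.variance (Q n) (f n)" for n
  define w where "w n = sqrt (measure_pmf.variance (P n) (f n))" for n
  have v0: "0 \<le> v n" for n unfolding v_def by simp
  assume "strongly_separates f P Q"
  then have nz: "\<forall>\<^sub>F n in sequentially. \<bar>d n\<bar> \<noteq> 0"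
    and lim: "(\<lambda>n. max (w n) (sqrt (v n)) / \<bar>d n\<bar>) \<longlonglongrightarrow> 0"
    by (simp_all add: strongly_separates_def little_o_def d_def v_def w_def)
  have "\<forall>\<^sub>F n in sequentially. max (w n) (sqrt (v n)) / \<bar>d n\<bar> < 1 / sqrt (A + 1)"
    using lim assms(1) by (intro order_tendstoD(2)[OF lim]) auto
  with nz have "\<forall>\<^sub>F n in sequentially. A * v n < (d n)\<^sup>2"
  proof eventually_elim
    case (elim n)
    have "sqrt (v n) / \<bar>d n\<bar> \<le> max (w n) (sqrt (v n)) / \<bar>d n\<bar>"
      by (intro divide_right_mono) auto
    then have "sqrt (v n) / \<bar>d n\<bar> < 1 / sqrt (A + 1)" using elim(2) by linarith
    then have "sqrt (v n) * sqrt (A + 1) < \<bar>d n\<bar>"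
      using elim(1) assms(1) by (simp add: field_simps)
    then have "(sqrt (v n) * sqrt (A + 1))\<^sup>2 < \<bar>d n\<bar>\<^sup>2"
      using v0 assms(1) by (intro power_strict_mono) auto
    then have "v n * (A + 1) < (d n)\<^sup>2" using v0 assms(1) by (simp add: power_mult_distrib)
    then show ?case using v0[of n] by (simp add: algebra_simps)
  qed
  then have "\<not> (\<exists>\<^sub>F n in sequentially. (d n)\<^sup>2 \<le> A * v n)"
    by (simp add: not_frequently not_le)
  then show False using assms(2) by (simp add: d_def v_def)
qed

section \<open>The signed edge count above the threshold\<close>

lemma expectation_erdos_renyi_chi:
  assumes "0 < p" "p < 1" "e \<in> pairs n"
  shows "measure_pmf.expectation (erdos_renyi n p) (chi p e) = 0"
  using expectation_erdos_renyi_char_monomial[OF assms(1,2), of "{e}" n] assms(3)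
  by (simp add: char_monomial_def[abs_def])

lemma partial_signed_edge_count_moments:
  assumes "0 < p" "p < 1" "S \<subseteq> pairs n"
  shows "measure_pmf.expectation (erdos_renyi n p) (\<lambda>G. \<Sum>e\<in>S. chi p e G) = 0"
    and "measure_pmf.expectation (erdos_renyi n p) (\<lambda>G. (\<Sum>e\<in>S. chi p e G)\<^sup>2) = real (card S)"
proof -
  have fin: "finite S" using assms(3) finite_pairs finite_subset by blast
  have chi: "chi p e G = char_monomial p {e} G" for e G by (simp add: char_monomial_def)
  have eq: "(\<Sum>e\<in>S. chi p e G) = (\<Sum>\<alpha>\<in>(\<lambda>e. {e}) ` S. 1 * char_monomial p \<alpha> G)" for G
    by (simp add: chi sum.reindex)
  show "measure_pmf.expectation (erdos_renyi n p) (\<lambda>G. \<Sum>e\<in>S. chi p e G) = 0"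
    using assms(3) by (simp add: integrable_erdos_renyi expectation_erdos_renyi_chi[OF assms(1,2)] subset_iff)
  show "measure_pmf.expectation (erdos_renyi n p) (\<lambda>G. (\<Sum>e\<in>S. chi p e G)\<^sup>2) = real (card S)"
    unfolding eq using assms(3) fin
    by (subst expectation_square_char_sum[OF assms(1,2)]) (auto simp: card_image)
qed

lemma signed_edge_count_null:
  assumes "0 < p" "p < 1"
  shows "measure_pmf.expectation (erdos_renyi n p) (signed_edge_count n p) = 0"
    and "measure_pmf.variance (erdos_renyi n p) (signed_edge_count n p) = real (card (pairs n))"
  using partial_signed_edge_count_moments[OF assms, of "pairs n" n]
  by (simp_all add: signed_edge_count_def[abs_def])

text \<open>
  At a fixed position the edges of the copy contribute the constant \<open>((1 - p)/p)\<^bsup>1/2\<^esup> |E(H)|\<close>,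
  the same for every position. The position therefore adds nothing to the variance, which comes
  only from the pairs outside the copy.
\<close>

lemma signed_edge_count_planted:
  assumes p: "0 < p" "p < 1" and H: "H \<in> graphs k" and k: "k \<le> n"
  shows "measure_pmf.expectation (planted n p k H) (signed_edge_count n p) = sqrt ((1 - p) / p) * real (card (Collect H))"
    and "measure_pmf.variance (planted n p k H) (signed_edge_count n p) \<le> real (card (pairs n))"
proof -
  define \<mu> where "\<mu> = sqrt ((1 - p) / p) * real (card (Collect H))"
  have pos: "card (injections k n) > 0"
    using injections_nonempty[OF k] finite_injections by (simp add: card_gt_0_iff)
  have split: "signed_edge_count n p (graph_union G (graph_image \<phi> H)) =
      \<mu> + (\<Sum>e\<in>pairs n - Collect (graph_image \<phi> H). chi p e G)" if \<phi>: "\<phi> \<in> injections k n" for \<phi> G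
  proof -
    let ?K = "graph_image \<phi> H"
    have sub: "Collect ?K \<subseteq> pairs n" using edges_subset[OF graph_image_in_graphs[OF \<phi> H]] .
    have "signed_edge_count n p (graph_union G ?K) =
      (\<Sum>e\<in>pairs n - Collect ?K. chi p e (graph_union G ?K)) + (\<Sum>e\<in>Collect ?K. chi p e (graph_union G ?K))"
      unfolding signed_edge_count_def by (rule sum.subset_diff[OF sub finite_pairs])
    also have "(\<Sum>e\<in>pairs n - Collect ?K. chi p e (graph_union G ?K)) = (\<Sum>e\<in>pairs n - Collect ?K. chi p e G)"
      by (intro sum.cong) (auto simp: chi_def graph_union_def)
    also have "(\<Sum>e\<in>Collect ?K. chi p e (graph_union G ?K)) = (\<Sum>e\<in>Collect ?K. sqrt ((1 - p) / p))"
      using chi_moments(3)[OF p] by (intro sum.cong) (auto simp: chi_def graph_union_def)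
    finally show ?thesis by (simp add: \<mu>_def card_edges_graph_image[OF \<phi> H])
  qed
  note mom = partial_signed_edge_count_moments[OF p]
  have "measure_pmf.expectation (planted n p k H) (signed_edge_count n p) =
    (\<Sum>\<phi>\<in>injections k n. \<mu>) / real (card (injections k n))"
    unfolding expectation_planted[OF k]
    by (intro arg_cong2[where f = "(/)"] sum.cong refl) (simp add: split integrable_erdos_renyi expectation_erdos_renyi_chi[OF p])
  then show E: "measure_pmf.expectation (planted n p k H) (signed_edge_count n p) = sqrt ((1 - p) / p) * real (card (Collect H))"
    using pos by (simp add: \<mu>_def)
  have "measure_pmf.variance (planted n p k H) (signed_edge_count n p) =
    (\<Sum>\<phi>\<in>injections k n. real (card (pairs n - Collect (graph_image \<phi> H)))) / real (card (injections k n))"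
    unfolding E unfolding \<mu>_def[symmetric] unfolding expectation_planted[OF k]
    by (intro arg_cong2[where f = "(/)"] sum.cong refl) (simp add: split mom(2))
  also have "\<dots> \<le> (\<Sum>\<phi>\<in>injections k n. real (card (pairs n))) / real (card (injections k n))"
    using finite_pairs by (intro divide_right_mono sum_mono) (auto intro: card_mono)
  also have "\<dots> = real (card (pairs n))" using pos by simp
  finally show "measure_pmf.variance (planted n p k H) (signed_edge_count n p) \<le> real (card (pairs n))" .
qed

text \<open>
  Mean gaps and standard deviations scale by the same factor. This transfers separation from the
  signed edge count to the number of edges, which has a simpler polynomial.
\<close>

lemma strongly_separates_affine:
  assumes sep: "strongly_separates f P Q" and a: "\<And>n. a n > 0"
    and g: "\<And>n G. g n G = a n * f n G + b n"
    and fin: "\<And>n. finite (set_pmf (P n))" "\<And>n. finite (set_pmf (Q n))"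
  shows "strongly_separates g P Q"
proof -
  have E: "measure_pmf.expectation M (g n) = a n * measure_pmf.expectation M (f n) + b n"
    if "finite (set_pmf M)" for M n
    using that by (simp add: g[abs_def] integrable_measure_pmf_finite)
  have V: "sqrt (measure_pmf.variance M (g n)) = a n * sqrt (measure_pmf.variance M (f n))"
    if "finite (set_pmf M)" for M n
  proof -
    have "measure_pmf.variance M (g n) = measure_pmf.expectation M (\<lambda>G. (a n)\<^sup>2 * (f n G - measure_pmf.expectation M (f n))\<^sup>2)"
      unfolding E[OF that] g by (simp add: power_mult_distrib[symmetric] algebra_simps)
    then show ?thesis using a[of n] by (simp add: real_sqrt_mult)
  qed
  have "max (sqrt (measure_pmf.variance (P n) (g n))) (sqrt (measure_pmf.variance (Q n) (g n))) =
     a n * max (sqrt (measure_pmf.variance (P n) (f n))) (sqrt (measure_pmf.variance (Q n) (f n)))" for n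
    using a[of n] by (simp add: V fin max_mult_distrib_left)
  moreover have "\<bar>measure_pmf.expectation (P n) (g n) - measure_pmf.expectation (Q n) (g n)\<bar> =
     a n * \<bar>measure_pmf.expectation (P n) (f n) - measure_pmf.expectation (Q n) (f n)\<bar>" for n
    using a[of n] by (simp add: E fin abs_mult right_diff_distrib[symmetric])
  moreover have "a n \<noteq> 0" for n using a[of n] by simp
  ultimately show ?thesis using sep unfolding strongly_separates_def little_o_def by simp
qed

definition edge_count_poly :: "nat \<Rightarrow> edge_poly" where
  "edge_count_poly n = (\<Sum>e\<in>pairs n. Poly_Mapping.single (Poly_Mapping.single e 1) 1)"

lemma inj_single_Suc_0: "inj_on (\<lambda>e. Poly_Mapping.single e (Suc 0)) A"
  by (auto simp: inj_on_def dest!: arg_cong[where f = Poly_Mapping.keys])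

lemma lookup_edge_count_poly:
  "Poly_Mapping.lookup (edge_count_poly n) m = of_bool (m \<in> (\<lambda>e. Poly_Mapping.single e 1) ` pairs n)"
proof -
  have "Poly_Mapping.lookup (edge_count_poly n) m = (\<Sum>m'\<in>(\<lambda>e. Poly_Mapping.single e 1) ` pairs n. if m' = m then 1 else 0)"
    by (simp add: edge_count_poly_def lookup_sum lookup_single when_def sum.reindex[OF inj_single_Suc_0])
  also have "\<dots> = of_bool (m \<in> (\<lambda>e. Poly_Mapping.single e 1) ` pairs n)"
    using finite_pairs by (subst sum.delta) auto
  finally show ?thesis .
qed

lemma keys_edge_count_poly:
  "Poly_Mapping.keys (edge_count_poly n) = (\<lambda>e. Poly_Mapping.single e 1) ` pairs n"
  by (auto simp: in_keys_iff lookup_edge_count_poly)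

lemma constant_degree_edge_count_poly: "constant_degree edge_count_poly"
proof -
  have "total_degree (edge_count_poly n) \<le> 1" for n
    unfolding total_degree_def keys_edge_count_poly using finite_pairs by auto
  moreover have "poly_vars (edge_count_poly n) \<subseteq> pairs n" for n
    by (auto simp: poly_vars_def keys_edge_count_poly)
  ultimately show ?thesis unfolding constant_degree_def by blast
qed

lemma eval_edge_count_poly:
  assumes "0 < p" "p < 1"
  shows "eval_poly (edge_count_poly n) G = sqrt (p * (1 - p)) * signed_edge_count n p G + p * real (card (pairs n))"
proof -
  have "eval_poly (edge_count_poly n) G = (\<Sum>e\<in>pairs n. of_bool (G e))"
    unfolding eval_poly_def keys_edge_count_poly by (simp add: sum.reindex[OF inj_single_Suc_0] lookup_edge_count_poly)
  also have "\<dots> = (\<Sum>e\<in>pairs n. sqrt (p * (1 - p)) * chi p e G + p)"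
    using assms by (intro sum.cong) (auto simp: chi_def)
  finally show ?thesis by (simp add: signed_edge_count_def sum.distrib sum_distrib_left)
qed

text \<open>
  The standard deviations are at most \<open>n\<close> and the gap is at least \<open>n\<rho>/8\<close>.
\<close>

lemma signed_edge_count_separates:
  fixes k :: "nat \<Rightarrow> nat" and p q :: "nat \<Rightarrow> real"
  assumes p: "\<And>n. 0 < p n \<and> p n < 1" and q: "\<And>n. 0 \<le> q n" and k: "\<And>n. k n \<le> n"
    and H: "\<And>n. H n \<in> graphs (k n)" "\<forall>\<^sub>F n in sequentially. H n \<in> typical_graphs (k n) (q n)"
    and lim: "filterlim (\<lambda>n. (real (k n))\<^sup>2 * q n * sqrt (1 - p n) / real n) at_top sequentially"
  shows "strongly_separates (\<lambda>n. signed_edge_count n (p n))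
    (\<lambda>n. planted n (p n) (k n) (H n)) (\<lambda>n. erdos_renyi n (p n))"
proof -
  define \<rho> where "\<rho> n = (real (k n))\<^sup>2 * q n * sqrt (1 - p n) / real n" for n
  define s where "s n = max (sqrt (measure_pmf.variance (planted n (p n) (k n) (H n)) (signed_edge_count n (p n))))
      (sqrt (measure_pmf.variance (erdos_renyi n (p n)) (signed_edge_count n (p n))))" for n
  define d where "d n = \<bar>measure_pmf.expectation (planted n (p n) (k n) (H n)) (signed_edge_count n (p n)) -
      measure_pmf.expectation (erdos_renyi n (p n)) (signed_edge_count n (p n))\<bar>" for n
  have s: "0 \<le> s n" "s n \<le> real n" for n
  proof -
    have "card (pairs n) \<le> n\<^sup>2"
      unfolding card_pairs choose_two power2_eq_square
      by (rule order_trans[OF div_le_dividend]) simp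
    then have le: "sqrt (real (card (pairs n))) \<le> real n"
      by (intro real_le_lsqrt) (auto simp flip: of_nat_power)
    have "s n \<le> sqrt (real (card (pairs n)))"
      unfolding s_def using signed_edge_count_planted(2)[OF _ _ H(1) k] signed_edge_count_null(2) p
      by (simp add: real_sqrt_le_mono)
    then show "s n \<le> real n" using le by linarith
    show "0 \<le> s n" unfolding s_def by (simp add: le_max_iff_disj)
  qed
  have pos: "\<forall>\<^sub>F n in sequentially. \<rho> n \<ge> 1" using lim by (simp add: filterlim_at_top \<rho>_def)
  have n0: "\<forall>\<^sub>F n in sequentially. n > (0 :: nat)" by (rule eventually_gt_at_top)
  have main: "\<forall>\<^sub>F n in sequentially. d n > 0 \<and> s n / d n \<le> 8 / \<rho> n"
    using pos n0 H(2)
  proof eventually_elim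
    case (elim n)
    have p': "0 < p n" "p n < 1" using p[of n] by auto
    have "(1 - p n) * p n \<le> 1 - p n" using p' by (intro mult_left_le) auto
    then have "1 - p n \<le> (1 - p n) / p n" using p' by (simp add: pos_le_divide_eq)
    then have "sqrt (1 - p n) * ((real (k n))\<^sup>2 * q n / 8) \<le> sqrt ((1 - p n) / p n) * real (card (Collect (H n)))"
      using elim(3) p' q[of n] unfolding typical_graphs_def
      by (intro mult_mono') auto
    also have "\<dots> \<le> d n"
      unfolding d_def signed_edge_count_planted(1)[OF p' H(1) k] signed_edge_count_null(1)[OF p'] by simp
    also have "sqrt (1 - p n) * ((real (k n))\<^sup>2 * q n / 8) = real n * \<rho> n / 8"
      using elim(2) by (simp add: \<rho>_def)
    finally have d: "real n * \<rho> n / 8 \<le> d n" .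
    have np: "0 < real n * \<rho> n / 8" using elim by simp
    then have d0: "d n > 0" using d by linarith
    have "s n / d n \<le> real n / (real n * \<rho> n / 8)"
      using s d np by (intro frac_le) auto
    then show ?case using d0 elim by simp
  qed
  have "(\<lambda>n. 8 / \<rho> n) \<longlonglongrightarrow> 0"
    using lim unfolding \<rho>_def[symmetric] by (intro tendsto_divide_0[OF tendsto_const] filterlim_at_top_imp_at_infinity)
  then have "(\<lambda>n. s n / d n) \<longlonglongrightarrow> 0"
  proof (rule tendsto_sandwich[OF _ _ tendsto_const, rotated -1])
    show "\<forall>\<^sub>F n in sequentially. 0 \<le> s n / d n" using main by eventually_elim (simp add: s(1))
    show "\<forall>\<^sub>F n in sequentially. s n / d n \<le> 8 / \<rho> n" using main by eventually_elim simp
  qed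
  moreover have "\<forall>\<^sub>F n in sequentially. d n \<noteq> 0" using main by eventually_elim simp
  ultimately show ?thesis
    unfolding strongly_separates_def little_o_def s_def d_def by simp
qed

section \<open>The detection threshold\<close>

lemma threshold_ratio_square:
  fixes k q n p :: real
  assumes "0 \<le> q" "p < 1" "0 \<le> n"
  shows "(k / (sqrt n / (sqrt q * (1 - p) powr (1/4))))\<^sup>2 = k\<^sup>2 * q * sqrt (1 - p) / n"
proof -
  have "((1 - p) powr (1/4))\<^sup>2 = (1 - p) powr (1/2)"
    by (simp add: power2_eq_square powr_add[symmetric])
  also have "\<dots> = sqrt (1 - p)" using assms by (simp add: powr_half_sqrt)
  finally show ?thesis
    using assms by (simp add: power_divide power_mult_distrib)
qed

theorem corollary3p4:
  fixes p q :: "nat \<Rightarrow> real" and k :: "nat \<Rightarrow> nat"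
  assumes "\<And>n. 0 < p n \<and> p n < 1"
    and "liminf (\<lambda>n. ereal (p n)) > 0"
    and "\<And>n. k n \<le> n"
    and "\<And>n. 0 < q n \<and> q n \<le> 1"
    and "little_omega (\<lambda>n. real (k n) * q n) (\<lambda>n. ln (real (k n)))"
  shows "\<exists>\<H> :: nat \<Rightarrow> graph set.
    (\<forall>n. \<H> n \<subseteq> graphs (k n)) \<and>
    (\<lambda>n. measure_pmf.prob (erdos_renyi (k n) (q n)) (\<H> n)) \<longlonglongrightarrow> 1 \<and>
    (\<forall>H. (\<forall>n. H n \<in> graphs (k n)) \<and> (\<forall>\<^sub>F n in sequentially. H n \<in> \<H> n) \<longrightarrow>
      ((\<exists>F. constant_degree F \<and>
            strongly_separates (\<lambda>n. eval_poly (F n))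
              (\<lambda>n. planted n (p n) (k n) (H n)) (\<lambda>n. erdos_renyi n (p n)))
        \<longleftrightarrow> little_omega (\<lambda>n. real (k n))
              (\<lambda>n. sqrt (real n) / (sqrt (q n) * (1 - p n) powr (1/4)))) \<and>
      (little_omega (\<lambda>n. real (k n))
          (\<lambda>n. sqrt (real n) / (sqrt (q n) * (1 - p n) powr (1/4))) \<longrightarrow>
        strongly_separates (\<lambda>n. signed_edge_count n (p n))
          (\<lambda>n. planted n (p n) (k n) (H n)) (\<lambda>n. erdos_renyi n (p n))))"
proof (intro exI[of _ "\<lambda>n. typical_graphs (k n) (q n)"] conjI allI impI)
  show "typical_graphs (k n) (q n) \<subseteq> graphs (k n)" for n by (auto simp: typical_graphs_def)
  show "(\<lambda>n. measure_pmf.prob (erdos_renyi (k n) (q n)) (typical_graphs (k n) (q n))) \<longlonglongrightarrow> 1"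
    by (rule typical_graphs_asymptotically_almost_sure[OF assms(4,5)])
  fix H assume "(\<forall>n. H n \<in> graphs (k n)) \<and> (\<forall>\<^sub>F n in sequentially. H n \<in> typical_graphs (k n) (q n))"
  then have H: "\<And>n. H n \<in> graphs (k n)" "\<forall>\<^sub>F n in sequentially. H n \<in> typical_graphs (k n) (q n)"
    by auto
  define r where "r n = real (k n) / (sqrt (real n) / (sqrt (q n) * (1 - p n) powr (1/4)))" for n
  let ?omega = "little_omega (\<lambda>n. real (k n)) (\<lambda>n. sqrt (real n) / (sqrt (q n) * (1 - p n) powr (1/4)))"
  have r2: "(r n)\<^sup>2 = (real (k n))\<^sup>2 * q n * sqrt (1 - p n) / real n" for n
    unfolding r_def using assms(1,4) by (intro threshold_ratio_square) (auto intro: less_imp_le)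
  have r0: "0 \<le> r n" for n unfolding r_def using assms(4)[of n] by simp
  show sep: "strongly_separates (\<lambda>n. signed_edge_count n (p n))
      (\<lambda>n. planted n (p n) (k n) (H n)) (\<lambda>n. erdos_renyi n (p n))" if ?omega
  proof (rule signed_edge_count_separates[OF assms(1) _ assms(3) H])
    show "0 \<le> q n" for n using assms(4)[of n] by simp
    have "filterlim r at_top sequentially" using that by (simp add: little_omega_def r_def[abs_def])
    then have "filterlim (\<lambda>n. (r n)\<^sup>2) at_top sequentially" by (intro filterlim_pow_at_top) auto
    then show "filterlim (\<lambda>n. (real (k n))\<^sup>2 * q n * sqrt (1 - p n) / real n) at_top sequentially"
      by (simp add: r2)
  qed
  show "(\<exists>F. constant_degree F \<and> strongly_separates (\<lambda>n. eval_poly (F n))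
      (\<lambda>n. planted n (p n) (k n) (H n)) (\<lambda>n. erdos_renyi n (p n))) \<longleftrightarrow> ?omega"
  proof
    assume ?omega
    have "strongly_separates (\<lambda>n. eval_poly (edge_count_poly n))
        (\<lambda>n. planted n (p n) (k n) (H n)) (\<lambda>n. erdos_renyi n (p n))"
    proof (rule strongly_separates_affine[OF sep[OF \<open>?omega\<close>]])
      show "sqrt (p n * (1 - p n)) > 0" for n using assms(1)[of n] by simp
      show "eval_poly (edge_count_poly n) G =
          sqrt (p n * (1 - p n)) * signed_edge_count n (p n) G + p n * real (card (pairs n))" for n G
        using assms(1)[of n] by (intro eval_edge_count_poly) auto
    qed (use finite_set_planted assms(3) finite_set_erdos_renyi in auto)
    then show "\<exists>F. constant_degree F \<and> strongly_separates (\<lambda>n. eval_poly (F n))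
      (\<lambda>n. planted n (p n) (k n) (H n)) (\<lambda>n. erdos_renyi n (p n))"
      using constant_degree_edge_count_poly by blast
  next
    assume "\<exists>F. constant_degree F \<and> strongly_separates (\<lambda>n. eval_poly (F n))
      (\<lambda>n. planted n (p n) (k n) (H n)) (\<lambda>n. erdos_renyi n (p n))"
    then obtain F D where F: "\<And>n. poly_vars (F n) \<subseteq> pairs n" "\<And>n. total_degree (F n) \<le> D"
      and sepF: "strongly_separates (\<lambda>n. eval_poly (F n))
        (\<lambda>n. planted n (p n) (k n) (H n)) (\<lambda>n. erdos_renyi n (p n))"
      by (auto simp: constant_degree_def)
    show ?omega
    proof (rule ccontr)
      assume "\<not> ?omega"
      then have "\<not> filterlim r at_top sequentially" by (simp add: little_omega_def r_def[abs_def])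
      then obtain Z where "\<not> (\<forall>\<^sub>F n in sequentially. Z \<le> r n)" unfolding filterlim_at_top by blast
      then have below: "\<exists>\<^sub>F n in sequentially. r n < Z" by (simp add: frequently_def not_less)
      obtain p0 where p0: "0 < ereal p0" "ereal p0 < liminf (\<lambda>n. ereal (p n))"
        using ereal_dense2[OF assms(2)] by auto
      have evp: "\<forall>\<^sub>F n in sequentially. p0 < p n" using less_LiminfD[OF p0(2)] by simp
      \<comment> \<open>Failure of the threshold condition only bounds \<open>r\<close> for infinitely many \<open>n\<close>; the gap bound holds there with the same constant.\<close>
      define A where "A = (\<Sum>j=1..D. ((256 * (Z\<^sup>2)\<^sup>2 + 64 * real D * Z\<^sup>2 + 4 * (real D)\<^sup>2) / p0) ^ j)"
      have A0: "0 \<le> A" unfolding A_def using p0(1) by (intro sum_nonneg) auto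
      have "\<forall>\<^sub>F n in sequentially. p0 < p n \<and> 4 * D + 4 \<le> n \<and> H n \<in> typical_graphs (k n) (q n)"
        using evp H(2) eventually_ge_at_top[of "4 * D + 4"] by eventually_elim auto
      from frequently_eventually_conj[OF below this]
      have "\<exists>\<^sub>F n in sequentially.
        (measure_pmf.expectation (planted n (p n) (k n) (H n)) (eval_poly (F n)) -
         measure_pmf.expectation (erdos_renyi n (p n)) (eval_poly (F n)))\<^sup>2
        \<le> A * measure_pmf.variance (erdos_renyi n (p n)) (eval_poly (F n))"
      proof (rule frequently_elim1)
        fix n assume n: "(p0 < p n \<and> 4 * D + 4 \<le> n \<and> H n \<in> typical_graphs (k n) (q n)) \<and> r n < Z"
        have "(r n)\<^sup>2 \<le> Z\<^sup>2" using n r0[of n] by (intro power_mono) auto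
        then show "(measure_pmf.expectation (planted n (p n) (k n) (H n)) (eval_poly (F n)) -
           measure_pmf.expectation (erdos_renyi n (p n)) (eval_poly (F n)))\<^sup>2
          \<le> A * measure_pmf.variance (erdos_renyi n (p n)) (eval_poly (F n))"
          unfolding A_def r2 using n p0(1) assms(1,3,4) F
          by (intro typical_graphs_gap_bound) (auto intro: less_imp_le)
      qed
      then show False
        using not_strongly_separates[OF A0, of "\<lambda>n. planted n (p n) (k n) (H n)"
            "\<lambda>n. eval_poly (F n)" "\<lambda>n. erdos_renyi n (p n)"] sepF by simp
    qed
  qed
qed

end
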